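(* Let $\phi:\mathbb{R}^2\to\mathbb{R}$ be any strictly convex differentiable function and let $D_\phi(x,y)=\phi(x)-\phi(y)-\langle x-y,\nabla\phi(y)\rangle$ be the corresponding Bregman loss function. Let $\mathbb{E}_{x_{\mathrm{new}}}[\phi(q_\star)]$ be finite. Then the expected Bregman loss $\mathbb{E}_{x_{\mathrm{new}}}[D_\phi(q_\star,\hat q_F)]$ admits a unique minimizer (up to almost sure equivalence) among all $\hat q_F$, $F\in\mathcal{F}:=\{f:\mathbb{R}\to[0,1]\text{ measurable}\}$. Let this minimizer be $F_\star=\arg\min_{F\in\mathcal{F}}\mathbb{E}_{x_{\mathrm{new}}}[D_\phi(q_\star,\hat q_F)]$. Suppose further that the link function $\sigma:\mathbb{R}\to[0,1]$ is continuous, and let $\hat\theta$ be a consistent estimator of $\theta_*$, i.e. $|\hat\theta-\theta_*|\to0$ in probability. Then, as $n,d\to\infty$, $$\left\|\hat q_{\mathrm{ang}}(\hat\theta)-\hat q_{F_\star}\right\|_2^2\to 0$$ in probability.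
   Context: Data: for each $d$ in a sequence of problem instances (with $n=n(d)$), i.i.d. pairs $(x_i,y_i)$, $i=1,\dots,n$, are observed with $x_i\sim N(0,\Sigma)$ in $\mathbb{R}^d$, $\Sigma$ a known covariance matrix, and, conditionally on $x_i$, $y_i\sim\mathrm{Bern}(\sigma(w_\star^\top x_i))$. Here $w_\star\in\mathbb{R}^d$ is deterministic and, without loss of generality, $\|w_\star\|_\Sigma=1$, where $\langle u,v\rangle_\Sigma=u^\top\Sigma v$ and $\|u\|_\Sigma=\sqrt{u^\top\Sigma u}$. Estimator: $\hat w=\arg\min_w \frac1n\sum_{i=1}^n\ell_{y_i}(w^\top x_i)+g(w)$, with $\ell$ a convex loss and $g$ a convex penalty (with $\hat w\neq 0$ so that the angle below is defined). Angle: $\theta_*=\arccos\left(\frac{\langle w_\star,\hat w\rangle_\Sigma}{\|\hat w\|_\Sigma\|w_\star\|_\Sigma}\right)$. The estimator $\hat\theta$ is computed from observed data (training and possibly held-out), independent of $x_{\mathrm{new}}$. Angular predictor: for an angle $\theta$ and $u\in\mathbb{R}$, $$\hat f_{\mathrm{ang}}(u;\theta)=\mathbb{E}_Z\left[\sigma\left(\cos(\theta)\cdot\frac{u}{\|\hat w\|_\Sigma}+\sin(\theta)\cdot Z\right)\right],\qquad Z\sim N(0,1).$$ $x_{\mathrm{new}}\sim N(0,\Sigma)$ is a new point independent of the observed data, and $\mathbb{E}_{x_{\mathrm{new}}}$ is expectation over $x_{\mathrm{new}}$ with $\hat w$ held fixed. Random probability vectors in $\mathbb{R}^2$: $$q_\star=\begin{pmatrix}\sigma(w_\star^\top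 x_{\mathrm{new}})\\1-\sigma(w_\star^\top x_{\mathrm{new}})\end{pmatrix},\quad \hat q_F=\begin{pmatrix}F(\hat w^\top x_{\mathrm{new}})\\1-F(\hat w^\top x_{\mathrm{new}})\end{pmatrix},\quad \hat q_{\mathrm{ang}}(\theta)=\begin{pmatrix}\hat f_{\mathrm{ang}}(\hat w^\top x_{\mathrm{new}};\theta)\\1-\hat f_{\mathrm{ang}}(\hat w^\top x_{\mathrm{new}};\theta)\end{pmatrix}.$$ *)

theory Defs
  imports "HOL-Probability.Probability"
begin

text \<open>
  The dimension varies along the sequence of problem instances, so it cannot be a type. A vector of
  \<open>\<real>\<^sup>d\<close> is an element of the extensional product \<open>rvec d\<close>, and a \<open>d \<times> d\<close> matrix is a function
  of two indices of which only the entries below \<open>d\<close> are used.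
\<close>

abbreviation rvec :: "nat \<Rightarrow> (nat \<Rightarrow> real) set" where
  "rvec d \<equiv> {..<d} \<rightarrow>\<^sub>E UNIV"

abbreviation rvec_borel :: "nat \<Rightarrow> (nat \<Rightarrow> real) measure" where
  "rvec_borel d \<equiv> \<Pi>\<^sub>M i\<in>{..<d}. borel"

definition dotp :: "nat \<Rightarrow> (nat \<Rightarrow> real) \<Rightarrow> (nat \<Rightarrow> real) \<Rightarrow> real" where
  "dotp d u v = (\<Sum>i<d. u i * v i)"

definition sinner :: "nat \<Rightarrow> (nat \<Rightarrow> nat \<Rightarrow> real) \<Rightarrow> (nat \<Rightarrow> real) \<Rightarrow> (nat \<Rightarrow> real) \<Rightarrow> real" where
  "sinner d S u v = (\<Sum>i<d. \<Sum>j<d. u i * S i j * v j)"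

definition snorm :: "nat \<Rightarrow> (nat \<Rightarrow> nat \<Rightarrow> real) \<Rightarrow> (nat \<Rightarrow> real) \<Rightarrow> real" where
  "snorm d S u = sqrt (sinner d S u u)"

definition covariance_matrix :: "nat \<Rightarrow> (nat \<Rightarrow> nat \<Rightarrow> real) \<Rightarrow> bool" where
  "covariance_matrix d S \<longleftrightarrow>
     (\<forall>i<d. \<forall>j<d. S i j = S j i) \<and> (\<forall>u\<in>rvec d. 0 \<le> sinner d S u u)"

definition convex_fun_rvec :: "nat \<Rightarrow> ((nat \<Rightarrow> real) \<Rightarrow> real) \<Rightarrow> bool" where
  "convex_fun_rvec d g \<longleftrightarrow>
     (\<forall>u\<in>rvec d. \<forall>v\<in>rvec d. \<forall>t\<in>{0..1}.
        g (\<lambda>i\<in>{..<d}. (1 - t) * u i + t * v i) \<le> (1 - t) * g u + t * g v)"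


subsection \<open>Random elements\<close>

text \<open>
  \<open>X \<sim> N(0, \<Sigma>)\<close>, defined through linear functionals so that singular \<open>\<Sigma>\<close> is covered. The law
  \<open>N(0, v)\<close> is written as the law of \<open>sqrt v\<close> times a standard normal variable, since the library's
  \<open>normal_density 0 0\<close> is not a probability density, whereas \<open>N(0, 0)\<close> is the point mass at 0.
\<close>
definition gaussian_vector ::
  "'a measure \<Rightarrow> nat \<Rightarrow> (nat \<Rightarrow> nat \<Rightarrow> real) \<Rightarrow> ('a \<Rightarrow> nat \<Rightarrow> real) \<Rightarrow> bool" where
  "gaussian_vector M d S X \<longleftrightarrow>
     X \<in> M \<rightarrow>\<^sub>M rvec_borel d \<and>
     (\<forall>u\<in>rvec d. distr M borel (\<lambda>\<omega>. dotp d u (X \<omega>)) =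
        distr std_normal_distribution borel (\<lambda>z. sqrt (sinner d S u u) * z))"

text \<open>Conditionally on \<open>X\<close>, the label \<open>Y\<close> (\<open>True\<close> is 1, \<open>False\<close> is 0) has law \<open>Bern(p(X))\<close>.\<close>
definition cond_bernoulli ::
  "'a measure \<Rightarrow> 'b measure \<Rightarrow> ('a \<Rightarrow> 'b) \<Rightarrow> ('a \<Rightarrow> bool) \<Rightarrow> ('b \<Rightarrow> real) \<Rightarrow> bool" where
  "cond_bernoulli M N X Y p \<longleftrightarrow>
     Y \<in> M \<rightarrow>\<^sub>M count_space UNIV \<and>
     (AE \<omega> in M. real_cond_exp M (vimage_algebra (space M) X N) (\<lambda>\<omega>. of_bool (Y \<omega>)) \<omega> = p (X \<omega>))"

text \<open>
  Independence of two random elements; the library's \<open>indep_var\<close> requires both to have values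
  in the same type.
\<close>
definition indep_elements ::
  "'a measure \<Rightarrow> 'b measure \<Rightarrow> ('a \<Rightarrow> 'b) \<Rightarrow> 'c measure \<Rightarrow> ('a \<Rightarrow> 'c) \<Rightarrow> bool" where
  "indep_elements M A X B Y \<longleftrightarrow>
     X \<in> M \<rightarrow>\<^sub>M A \<and> Y \<in> M \<rightarrow>\<^sub>M B \<and>
     prob_space.indep_set M (sets (vimage_algebra (space M) X A)) (sets (vimage_algebra (space M) Y B))"

text \<open>The \<open>k\<close>-th variable lives on its own probability space \<open>M k\<close>.\<close>
definition tendsto_0_in_prob :: "(nat \<Rightarrow> 'a measure) \<Rightarrow> (nat \<Rightarrow> 'a \<Rightarrow> real) \<Rightarrow> bool" where
  "tendsto_0_in_prob M X \<longleftrightarrow>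
     (\<forall>k. X k \<in> borel_measurable (M k)) \<and>
     (\<forall>\<epsilon>>0. (\<lambda>k. measure (M k) {\<omega> \<in> space (M k). \<bar>X k \<omega>\<bar> > \<epsilon>}) \<longlonglongrightarrow> 0)"


subsection \<open>Estimator, angle, angular predictor\<close>

type_synonym sample = "nat \<Rightarrow> (nat \<Rightarrow> real) \<times> bool"

abbreviation sample_space :: "nat \<Rightarrow> nat \<Rightarrow> sample measure" where
  "sample_space n d \<equiv> \<Pi>\<^sub>M i\<in>{..<n}. (rvec_borel d \<Otimes>\<^sub>M count_space UNIV)"

definition reg_risk ::
  "nat \<Rightarrow> nat \<Rightarrow> (bool \<Rightarrow> real \<Rightarrow> real) \<Rightarrow> ((nat \<Rightarrow> real) \<Rightarrow> real) \<Rightarrow> sample \<Rightarrow> (nat \<Rightarrow> real) \<Rightarrow> real"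
  where
  "reg_risk n d l g D w = (1 / real n) * (\<Sum>i<n. l (snd (D i)) (dotp d w (fst (D i)))) + g w"

definition sangle ::
  "nat \<Rightarrow> (nat \<Rightarrow> nat \<Rightarrow> real) \<Rightarrow> (nat \<Rightarrow> real) \<Rightarrow> (nat \<Rightarrow> real) \<Rightarrow> real" where
  "sangle d S u v = arccos (sinner d S u v / (snorm d S v * snorm d S u))"

text \<open>The parameter \<open>r\<close> stands for the \<open>\<Sigma>\<close>-norm of the estimator.\<close>
definition f_ang :: "(real \<Rightarrow> real) \<Rightarrow> real \<Rightarrow> real \<Rightarrow> real \<Rightarrow> real" where
  "f_ang \<sigma> r \<theta> u = (\<integral>z. \<sigma> (cos \<theta> * (u / r) + sin \<theta> * z) \<partial>std_normal_distribution)"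


subsection \<open>Bregman losses\<close>

definition strictly_convex :: "('v::real_vector \<Rightarrow> real) \<Rightarrow> bool" where
  "strictly_convex f \<longleftrightarrow>
     (\<forall>x y t. x \<noteq> y \<longrightarrow> 0 < t \<longrightarrow> t < 1 \<longrightarrow>
        f ((1 - t) *\<^sub>R x + t *\<^sub>R y) < (1 - t) * f x + t * f y)"

definition gradient :: "('v::real_inner \<Rightarrow> real) \<Rightarrow> 'v \<Rightarrow> 'v" where
  "gradient f x = (THE D. GDERIV f x :> D)"

definition bregman :: "('v::real_inner \<Rightarrow> real) \<Rightarrow> 'v \<Rightarrow> 'v \<Rightarrow> real" where
  "bregman \<phi> x y = \<phi> x - \<phi> y - inner (x - y) (gradient \<phi> y)"

definition prob_vec :: "real \<Rightarrow> real ^ 2" where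
  "prob_vec p = vector [p, 1 - p]"

definition predictors :: "(real \<Rightarrow> real) set" where
  "predictors = {f \<in> borel_measurable borel. \<forall>u. f u \<in> {0..1}}"

text \<open>
  Expected loss of \<open>F\<close> for fixed weights \<open>w\<close>, where \<open>\<nu>\<close> is the law of the new point. The
  Bregman loss of a convex function is nonnegative, so the nonnegative integral is its expectation,
  without an integrability side condition.
\<close>
definition exp_bregman ::
  "(real ^ 2 \<Rightarrow> real) \<Rightarrow> (real \<Rightarrow> real) \<Rightarrow> nat \<Rightarrow> (nat \<Rightarrow> real) measure \<Rightarrow> (nat \<Rightarrow> real) \<Rightarrow> (nat \<Rightarrow> real)
     \<Rightarrow> (real \<Rightarrow> real) \<Rightarrow> ennreal" where
  "exp_bregman \<phi> \<sigma> d \<nu> wstar w F =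
     (\<integral>\<^sup>+x. ennreal (bregman \<phi> (prob_vec (\<sigma> (dotp d wstar x))) (prob_vec (F (dotp d w x)))) \<partial>\<nu>)"

definition bregman_minimizer ::
  "(real ^ 2 \<Rightarrow> real) \<Rightarrow> (real \<Rightarrow> real) \<Rightarrow> nat \<Rightarrow> (nat \<Rightarrow> real) measure \<Rightarrow> (nat \<Rightarrow> real) \<Rightarrow> (nat \<Rightarrow> real)
     \<Rightarrow> (real \<Rightarrow> real) \<Rightarrow> bool" where
  "bregman_minimizer \<phi> \<sigma> d \<nu> wstar w F \<longleftrightarrow>
     is_arg_min (exp_bregman \<phi> \<sigma> d \<nu> wstar w) (\<lambda>F. F \<in> predictors) F"

text \<open>
  The minimizer depends on the weights and is only determined up to a null set for each of them.
  For its value at a random estimator and a random point to be a random variable, well defined up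
  to almost sure equality, the versions have to be chosen jointly measurably.
\<close>
definition measurable_family :: "nat \<Rightarrow> ((nat \<Rightarrow> real) \<Rightarrow> real \<Rightarrow> real) \<Rightarrow> bool" where
  "measurable_family d F \<longleftrightarrow> (\<lambda>(w, u). F w u) \<in> borel_measurable (rvec_borel d \<Otimes>\<^sub>M borel)"

end

(*
  Conditionally on the score of the estimator, the true score is Gaussian, so the conditional mean
  of the label given the predicted score is the angular predictor at the true angle. For a Bregman
  loss restricted to the segment of probability vectors (where the convex function and its slope are
  bounded), conditional means minimize uniquely by the Pythagorean identity. The minimizer is thus
  explicit, and consistency reduces to the continuity of the angular predictor in the angle, uniform
  over compact sets of normalized scores; these scores are standard normal, hence tight.
*)
theory Submission
  imports Defs
begin

text \<open>A singular covariance is allowed, and the Gaussian vectors are known only through their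
  linear functionals, so no joint density is at hand. Independence of orthogonal functionals
  therefore comes from characteristic functions, with uniqueness applied on the real line only.

  The conditional mean is never formed as a conditional expectation: it enters as an identity
  against bounded test functions of the score. This is exactly what the Pythagorean identity
  consumes, because its cross term is a residual times a difference of slopes, a bounded function of
  the score.

  A minimizer is fixed only up to a null set that depends on the weights, and the weights are
  random. Independence of the new point and joint measurability let Fubini average over these null
  sets.

  The normal tail enters the consistency estimate twice: for the normalized score and for the noise
  integrated out in the angular predictor. Neither bound sees the dimension, so one modulus of
  continuity serves all instances.\<close>

subsection \<open>Independence through characteristic functions\<close>

text \<open>After division by its mean, \<open>h\<close> is a probability density. By
  \<open>char_eq\<close>, \<open>V\<close> has the same characteristic function under the tilted
  measure as under \<open>M\<close>, hence the same law, so the weight splits off for events as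
  well.\<close>

lemma (in prob_space) reweighted_expectation:
  fixes h V :: "'a \<Rightarrow> real"
  assumes [measurable]: "h \<in> borel_measurable M" "V \<in> borel_measurable M" "B \<in> sets borel"
    and h_nonneg: "\<And>\<omega>. 0 \<le> h \<omega>" and h_bound: "\<And>\<omega>. h \<omega> \<le> C"
    and char_eq: "\<And>b. (CLINT \<omega>|M. h \<omega> * iexp (b * V \<omega>)) = expectation h * (CLINT \<omega>|M. iexp (b * V \<omega>))"
  shows "expectation (\<lambda>\<omega>. h \<omega> * indicator B (V \<omega>)) = expectation h * expectation (\<lambda>\<omega>. indicator B (V \<omega>))"
proof -
  have int_h: "integrable M h"
    by (rule integrable_const_bound[where B=C]) (use h_nonneg h_bound in auto)
  show ?thesis
  proof (cases "expectation h = 0")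
    \<comment> \<open>A weight of mean zero cannot be normalized, but it vanishes almost everywhere
      and both sides are 0.\<close>
    case True
    then have "AE \<omega> in M. h \<omega> = 0"
      using integral_nonneg_eq_0_iff_AE[OF int_h] h_nonneg by auto
    then have "expectation (\<lambda>\<omega>. h \<omega> * indicator B (V \<omega>)) = expectation (\<lambda>\<omega>. 0)"
      by (intro integral_cong_AE) auto
    with True show ?thesis by simp
  next
    case False
    define E where "E = expectation h"
    have E: "0 < E"
      using False h_nonneg unfolding E_def by (simp add: integral_nonneg_AE less_le)
    define D where "D = density M (\<lambda>\<omega>. ennreal (h \<omega> / E))"
    have [measurable_cong, simp]: "sets D = sets M" and space_D[simp]: "space D = space M"
      by (auto simp: D_def)
    have "emeasure D (space D) = ennreal (expectation (\<lambda>\<omega>. h \<omega> / E))"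
      using E h_nonneg int_h unfolding D_def
      by (subst emeasure_density) (auto simp: nn_integral_eq_integral cong: nn_integral_cong)
    also have "\<dots> = 1"
      using False by (simp add: E_def)
    finally interpret D: prob_space D by (rule prob_spaceI)
    have "distr D borel V = distr M borel V"
    proof (rule Levy_uniqueness)
      show "real_distribution (distr D borel V)" "real_distribution (distr M borel V)"
        by (auto intro!: real_distribution_distr D.real_distribution_distr)
      show "char (distr D borel V) = char (distr M borel V)"
      proof
        fix b
        have "char (distr D borel V) b = (CLINT \<omega>|D. iexp (b * V \<omega>))"
          by (simp add: char_def integral_distr)
        also have "\<dots> = (CLINT \<omega>|M. (h \<omega> / E) *\<^sub>R iexp (b * V \<omega>))"
          using E h_nonneg unfolding D_def by (subst integral_density) auto
        also have "\<dots> = (CLINT \<omega>|M. (h \<omega> * iexp (b * V \<omega>)) / E)"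
          by (simp add: scaleR_conv_of_real)
        also have "\<dots> = (CLINT \<omega>|M. iexp (b * V \<omega>))"
          using False char_eq[of b] by (simp add: E_def)
        also have "\<dots> = char (distr M borel V) b"
          by (simp add: char_def integral_distr)
        finally show "char (distr D borel V) b = char (distr M borel V) b" .
      qed
    qed
    then have "(LINT v|distr D borel V. indicator B v) = (LINT v|distr M borel V. indicator B v :: real)"
      by simp
    then have "(LINT \<omega>|D. indicator B (V \<omega>)) = expectation (\<lambda>\<omega>. indicator B (V \<omega>) :: real)"
      by (subst (asm) (1 2) integral_distr) auto
    moreover have "(LINT \<omega>|D. indicator B (V \<omega>)) = expectation (\<lambda>\<omega>. (h \<omega> / E) *\<^sub>R indicator B (V \<omega>) :: real)"
      using E h_nonneg unfolding D_def by (subst integral_density) auto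
    ultimately have "expectation (\<lambda>\<omega>. (h \<omega> * indicator B (V \<omega>)) / E) = expectation (\<lambda>\<omega>. indicator B (V \<omega>) :: real)"
      by simp
    then show ?thesis
      using E by (simp add: E_def[symmetric] field_simps)
  qed
qed

text \<open>
  Kac's theorem. Fixing one frequency turns \<open>2 + cos (a U)\<close>, \<open>2 + sin (a U)\<close> into positive weights to
  which the one-dimensional uniqueness theorem applies; then the indicators of \<open>V\<close> serve as weights.
\<close>
lemma (in prob_space) distr_pair_eq_char:
  fixes U V :: "'a \<Rightarrow> real"
  assumes [measurable]: "U \<in> borel_measurable M" "V \<in> borel_measurable M"
    and char_eq: "\<And>a b. (CLINT \<omega>|M. iexp (a * U \<omega> + b * V \<omega>)) =
      (CLINT \<omega>|M. iexp (a * U \<omega>)) * (CLINT \<omega>|M. iexp (b * V \<omega>))"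
  shows "distr M (borel \<Otimes>\<^sub>M borel) (\<lambda>\<omega>. (U \<omega>, V \<omega>)) = distr M borel U \<Otimes>\<^sub>M distr M borel V"
proof -
  have ie[simp]: "integrable M (\<lambda>\<omega>. iexp (f \<omega>))" if [measurable]: "f \<in> borel_measurable M" for f
    by (rule integrable_const_bound[where B=1]) auto
  have mult: "(CLINT \<omega>|M. iexp (a * U \<omega>) * iexp (b * V \<omega>)) =
      (CLINT \<omega>|M. iexp (a * U \<omega>)) * (CLINT \<omega>|M. iexp (b * V \<omega>))" for a b
    using char_eq[of a b] by (simp add: exp_add[symmetric] distrib_left)
  have iem[simp]: "integrable M (\<lambda>\<omega>. iexp (f \<omega>) * iexp (g \<omega>))"
    if [measurable]: "f \<in> borel_measurable M" "g \<in> borel_measurable M" for f g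
    by (rule integrable_const_bound[where B=1]) (auto simp: norm_mult)
  have cos_iexp: "complex_of_real (cos t) = (iexp t + iexp (- t)) / 2" for t
    by (simp add: cos_of_real[symmetric] cos_exp_eq del: cos_of_real)
  have sin_iexp: "complex_of_real (sin t) = (iexp t - iexp (- t)) / (2 * \<i>)" for t
    by (simp add: sin_of_real[symmetric] sin_exp_eq del: sin_of_real)
  have ind_of_real: "(indicator B v :: complex) = of_real (indicator B v)" for B and v :: real
    by (simp add: indicator_def)
  \<comment> \<open>A mixed form: \<open>U\<close> is still tested by frequencies, \<open>V\<close>
    already by events.\<close>
  have indep_B: "(CLINT \<omega>|M. iexp (a * U \<omega>) * indicator B (V \<omega>)) =
      (CLINT \<omega>|M. iexp (a * U \<omega>)) * expectation (\<lambda>\<omega>. indicat_real B (V \<omega>))"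
    if [measurable]: "B \<in> sets borel" for a B
  proof -
    have int_c: "integrable M (\<lambda>\<omega>. cos (a * U \<omega>))" and int_s: "integrable M (\<lambda>\<omega>. sin (a * U \<omega>))"
      and int_cB: "integrable M (\<lambda>\<omega>. cos (a * U \<omega>) * indicator B (V \<omega>))"
      and int_sB: "integrable M (\<lambda>\<omega>. sin (a * U \<omega>) * indicator B (V \<omega>))"
      and int_B: "integrable M (\<lambda>\<omega>. indicator B (V \<omega>) :: real)"
      by (rule integrable_const_bound[where B=1]; auto simp: indicator_def)+
    have c1: "complex_of_real (expectation (\<lambda>\<omega>. cos (a * U \<omega>))) =
        ((CLINT \<omega>|M. iexp (a * U \<omega>)) + (CLINT \<omega>|M. iexp (- a * U \<omega>))) / 2"
      by (subst integral_complex_of_real[symmetric]) (use ie[of "\<lambda>\<omega>. - (a * U \<omega>)"] ie[of "\<lambda>\<omega>. a * U \<omega>"] in \<open>simp add: cos_iexp\<close>)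
    have s1: "complex_of_real (expectation (\<lambda>\<omega>. sin (a * U \<omega>))) =
        ((CLINT \<omega>|M. iexp (a * U \<omega>)) - (CLINT \<omega>|M. iexp (- a * U \<omega>))) / (2 * \<i>)"
      by (subst integral_complex_of_real[symmetric]) (use ie[of "\<lambda>\<omega>. - (a * U \<omega>)"] ie[of "\<lambda>\<omega>. a * U \<omega>"] in \<open>simp add: sin_iexp\<close>)
    have int_p: "integrable M (\<lambda>\<omega>. iexp (a * U \<omega>) * iexp (b * V \<omega>))"
      and int_m: "integrable M (\<lambda>\<omega>. iexp (- a * U \<omega>) * iexp (b * V \<omega>))" for b
      by (rule iem; measurable)+
    have c2: "(CLINT \<omega>|M. cos (a * U \<omega>) * iexp (b * V \<omega>)) =
        expectation (\<lambda>\<omega>. cos (a * U \<omega>)) * (CLINT \<omega>|M. iexp (b * V \<omega>))" for b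
    proof -
      have "(CLINT \<omega>|M. cos (a * U \<omega>) * iexp (b * V \<omega>)) =
         (CLINT \<omega>|M. (iexp (a * U \<omega>) * iexp (b * V \<omega>) + iexp (- a * U \<omega>) * iexp (b * V \<omega>)) / 2)"
        by (simp add: cos_iexp distrib_right)
      also have "\<dots> = ((CLINT \<omega>|M. iexp (a * U \<omega>) * iexp (b * V \<omega>)) + (CLINT \<omega>|M. iexp (- a * U \<omega>) * iexp (b * V \<omega>))) / 2"
        by (simp only: integral_divide_zero Bochner_Integration.integral_add[OF int_p int_m])
      finally show ?thesis
        unfolding c1 mult by (simp add: field_simps)
    qed
    have s2: "(CLINT \<omega>|M. sin (a * U \<omega>) * iexp (b * V \<omega>)) =
        expectation (\<lambda>\<omega>. sin (a * U \<omega>)) * (CLINT \<omega>|M. iexp (b * V \<omega>))" for b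
    proof -
      have "(CLINT \<omega>|M. sin (a * U \<omega>) * iexp (b * V \<omega>)) =
         (CLINT \<omega>|M. (iexp (a * U \<omega>) * iexp (b * V \<omega>) - iexp (- a * U \<omega>) * iexp (b * V \<omega>)) / (2 * \<i>))"
        by (rule Bochner_Integration.integral_cong) (simp_all add: sin_iexp field_simps)
      also have "\<dots> = ((CLINT \<omega>|M. iexp (a * U \<omega>) * iexp (b * V \<omega>)) - (CLINT \<omega>|M. iexp (- a * U \<omega>) * iexp (b * V \<omega>))) / (2 * \<i>)"
        by (simp only: integral_divide_zero Bochner_Integration.integral_diff[OF int_p int_m])
      finally show ?thesis
        unfolding s1 mult by (simp add: field_simps)
    qed
    have bounded_char: "integrable M (\<lambda>\<omega>. complex_of_real (f (a * U \<omega>)) * iexp (b * V \<omega>))"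
      if "f \<in> {sin, cos}" for f b
      using that by (intro integrable_const_bound[where B=1]) (auto simp: norm_mult)
    have weight: "expectation (\<lambda>\<omega>. f (a * U \<omega>) * indicator B (V \<omega>)) =
        expectation (\<lambda>\<omega>. f (a * U \<omega>)) * expectation (\<lambda>\<omega>. indicator B (V \<omega>))"
      if f: "f \<in> {sin, cos}" for f
    proof -
      have [measurable]: "f \<in> borel_measurable borel" using f by auto
      have fb: "\<bar>f t\<bar> \<le> 1" for t using f by auto
      have int_f: "integrable M (\<lambda>\<omega>. f (a * U \<omega>))" using f int_c int_s by auto
      have int_fB: "integrable M (\<lambda>\<omega>. f (a * U \<omega>) * indicator B (V \<omega>))" using f int_cB int_sB by auto
      have Ef: "expectation (\<lambda>\<omega>. 2 + f (a * U \<omega>)) = 2 + expectation (\<lambda>\<omega>. f (a * U \<omega>))"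
        using int_f by (simp add: prob_space)
      \<comment> \<open>The shift by 2 keeps the weight between 1 and 3; linearity removes it again
        below.\<close>
      have "expectation (\<lambda>\<omega>. (2 + f (a * U \<omega>)) * indicator B (V \<omega>)) =
          expectation (\<lambda>\<omega>. 2 + f (a * U \<omega>)) * expectation (\<lambda>\<omega>. indicator B (V \<omega>))"
      proof (rule reweighted_expectation[where C=3])
        show "0 \<le> 2 + f (a * U \<omega>)" "2 + f (a * U \<omega>) \<le> 3" for \<omega>
          using fb[of "a * U \<omega>"] by auto
        have f2: "(CLINT \<omega>|M. f (a * U \<omega>) * iexp (b * V \<omega>)) =
            expectation (\<lambda>\<omega>. f (a * U \<omega>)) * (CLINT \<omega>|M. iexp (b * V \<omega>))" for b
          using f c2 s2 by auto
        show "(CLINT \<omega>|M. (2 + f (a * U \<omega>)) * iexp (b * V \<omega>)) =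
            expectation (\<lambda>\<omega>. 2 + f (a * U \<omega>)) * (CLINT \<omega>|M. iexp (b * V \<omega>))" for b
          unfolding Ef using f2[of b] bounded_char[OF f, of b] ie[of "\<lambda>\<omega>. b * V \<omega>"]
          by (simp add: distrib_right)
      qed auto
      moreover have "expectation (\<lambda>\<omega>. (2 + f (a * U \<omega>)) * indicator B (V \<omega>)) =
          2 * expectation (\<lambda>\<omega>. indicator B (V \<omega>)) + expectation (\<lambda>\<omega>. f (a * U \<omega>) * indicator B (V \<omega>))"
        using int_fB int_B by (simp add: distrib_right)
      ultimately show ?thesis
        unfolding Ef by (simp add: distrib_right)
    qed
    have euler: "iexp t = of_real (cos t) + \<i> * of_real (sin t)" for t
      by (simp add: exp_Euler cos_of_real sin_of_real)
    have "(CLINT \<omega>|M. iexp (a * U \<omega>) * indicator B (V \<omega>)) =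
        (CLINT \<omega>|M. of_real (cos (a * U \<omega>) * indicator B (V \<omega>)) + \<i> * of_real (sin (a * U \<omega>) * indicator B (V \<omega>)))"
      by (simp only: euler ind_of_real) (simp add: algebra_simps)
    also have "\<dots> = of_real (expectation (\<lambda>\<omega>. cos (a * U \<omega>) * indicator B (V \<omega>)))
        + \<i> * of_real (expectation (\<lambda>\<omega>. sin (a * U \<omega>) * indicator B (V \<omega>)))"
      using int_cB int_sB
      by (subst Bochner_Integration.integral_add) (auto simp del: of_real_mult simp: integrable_of_real integral_complex_of_real)
    also have "\<dots> = (of_real (expectation (\<lambda>\<omega>. cos (a * U \<omega>))) + \<i> * of_real (expectation (\<lambda>\<omega>. sin (a * U \<omega>))))
        * expectation (\<lambda>\<omega>. indicat_real B (V \<omega>))"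
      using weight[of cos] weight[of sin] by (simp add: algebra_simps)
    also have "of_real (expectation (\<lambda>\<omega>. cos (a * U \<omega>))) + \<i> * of_real (expectation (\<lambda>\<omega>. sin (a * U \<omega>))) =
        (CLINT \<omega>|M. of_real (cos (a * U \<omega>)) + \<i> * of_real (sin (a * U \<omega>)))"
      using int_c int_s
      by (subst Bochner_Integration.integral_add) (auto simp: integrable_of_real integral_complex_of_real)
    finally show ?thesis
      by (simp only: euler)
  qed
  have rect: "prob {\<omega> \<in> space M. U \<omega> \<in> A \<and> V \<omega> \<in> B} = prob {\<omega> \<in> space M. U \<omega> \<in> A} * prob {\<omega> \<in> space M. V \<omega> \<in> B}"
    if [measurable]: "A \<in> sets borel" "B \<in> sets borel" for A B
  proof -
    have ind: "expectation (\<lambda>\<omega>. indicator S (W \<omega>)) = prob {\<omega> \<in> space M. W \<omega> \<in> S}"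
      if [measurable]: "S \<in> sets borel" "W \<in> borel_measurable M" for S and W :: "'a \<Rightarrow> real"
    proof -
      have "expectation (\<lambda>\<omega>. indicat_real S (W \<omega>)) = expectation (indicator {\<omega> \<in> space M. W \<omega> \<in> S})"
        by (rule Bochner_Integration.integral_cong) (auto simp: indicator_def)
      then show ?thesis by (simp add: Int_absorb1 subset_eq)
    qed
    \<comment> \<open>The roles are exchanged: the indicator of \<open>V\<close> is the weight, and
      \<open>indep_B\<close> supplies the condition on the characteristic function of
      \<open>U\<close>.\<close>
    have "expectation (\<lambda>\<omega>. indicat_real B (V \<omega>) * indicator A (U \<omega>)) =
        expectation (\<lambda>\<omega>. indicator B (V \<omega>)) * expectation (\<lambda>\<omega>. indicator A (U \<omega>))"
    proof (rule reweighted_expectation[where C=1])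
      show "(CLINT \<omega>|M. complex_of_real (indicat_real B (V \<omega>)) * iexp (b * U \<omega>)) =
          expectation (\<lambda>\<omega>. indicat_real B (V \<omega>)) * (CLINT \<omega>|M. iexp (b * U \<omega>))" for b
        using indep_B[of B b, OF that(2)] by (simp only: ind_of_real mult.commute)
    qed (auto simp: indicator_def)
    moreover have "expectation (\<lambda>\<omega>. indicat_real B (V \<omega>) * indicator A (U \<omega>)) =
        expectation (indicator {\<omega> \<in> space M. U \<omega> \<in> A \<and> V \<omega> \<in> B})"
      by (rule Bochner_Integration.integral_cong) (auto simp: indicator_def)
    ultimately show ?thesis
      by (simp add: ind Int_absorb1 subset_eq)
  qed
  interpret U: prob_space "distr M borel U" by (rule prob_space_distr) simp
  interpret V: prob_space "distr M borel V" by (rule prob_space_distr) simp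
  show ?thesis
  proof (rule pair_measure_eqI[symmetric])
    fix A B assume "A \<in> sets (distr M borel U)" "B \<in> sets (distr M borel V)"
    then have [measurable]: "A \<in> sets borel" "B \<in> sets borel" by auto
    have "emeasure (distr M (borel \<Otimes>\<^sub>M borel) (\<lambda>\<omega>. (U \<omega>, V \<omega>))) (A \<times> B) = prob {\<omega> \<in> space M. U \<omega> \<in> A \<and> V \<omega> \<in> B}"
      by (subst emeasure_distr) (auto simp: emeasure_eq_measure intro!: arg_cong[where f=prob])
    also have "\<dots> = ennreal (prob {\<omega> \<in> space M. U \<omega> \<in> A}) * ennreal (prob {\<omega> \<in> space M. V \<omega> \<in> B})"
      by (simp add: rect ennreal_mult)
    also have "\<dots> = emeasure (distr M borel U) A * emeasure (distr M borel V) B"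
      by (auto simp: emeasure_distr emeasure_eq_measure vimage_def Int_def conj_commute)
    finally show "emeasure (distr M borel U) A * emeasure (distr M borel V) B =
        emeasure (distr M (borel \<Otimes>\<^sub>M borel) (\<lambda>\<omega>. (U \<omega>, V \<omega>))) (A \<times> B)" by simp
  qed (simp_all add: U.sigma_finite_measure_axioms V.sigma_finite_measure_axioms cong: sets_pair_measure_cong)
qed

subsection \<open>Gaussian vectors and the angular predictor\<close>

text \<open>Nonnegativity of the form and the Gaussian law are assumed for extensional vectors only,
  so linear combinations have to be restricted before either applies. The forms do not notice the
  restriction.\<close>

lemma sinner_restrict [simp]:
  "sinner d S (restrict f {..<d}) v = sinner d S f v"
  "sinner d S u (restrict f {..<d}) = sinner d S u f"
  by (simp_all add: sinner_def)

lemma dotp_restrict [simp]: "dotp d (restrict f {..<d}) x = dotp d f x"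
  by (simp add: dotp_def)

lemma sinner_linear:
  "sinner d S (\<lambda>i. a * u i + b * v i) w = a * sinner d S u w + b * sinner d S v w"
  "sinner d S w (\<lambda>i. a * u i + b * v i) = a * sinner d S w u + b * sinner d S w v"
  by (simp_all add: sinner_def algebra_simps sum.distrib sum_distrib_left)

lemma dotp_linear: "dotp d (\<lambda>i. a * u i + b * v i) x = a * dotp d u x + b * dotp d v x"
  by (simp add: dotp_def algebra_simps sum.distrib sum_distrib_left)

lemma sinner_commute: "covariance_matrix d S \<Longrightarrow> sinner d S u v = sinner d S v u"
  unfolding sinner_def covariance_matrix_def
  by (subst sum.swap) (auto intro!: sum.cong)

lemma sinner_nonneg: "covariance_matrix d S \<Longrightarrow> u \<in> rvec d \<Longrightarrow> 0 \<le> sinner d S u u"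
  by (simp add: covariance_matrix_def)

lemma sinner_quadratic:
  assumes "covariance_matrix d S"
  shows "sinner d S (\<lambda>i. a * u i + b * v i) (\<lambda>i. a * u i + b * v i) =
    a\<^sup>2 * sinner d S u u + 2 * a * b * sinner d S u v + b\<^sup>2 * sinner d S v v"
  using sinner_commute[OF assms, of v u]
  by (simp add: sinner_linear power2_eq_square algebra_simps)

lemma snorm_power2: "covariance_matrix d S \<Longrightarrow> u \<in> rvec d \<Longrightarrow> (snorm d S u)\<^sup>2 = sinner d S u u"
  by (simp add: snorm_def sinner_nonneg)

lemma sinner_quadratic_nonneg:
  assumes "covariance_matrix d S"
  shows "0 \<le> a\<^sup>2 * sinner d S u u + 2 * a * b * sinner d S u v + b\<^sup>2 * sinner d S v v"
  using sinner_nonneg[OF assms, of "\<lambda>i\<in>{..<d}. a * u i + b * v i"]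
  by (simp add: sinner_quadratic[OF assms])

lemma sinner_Cauchy_Schwarz:
  assumes S: "covariance_matrix d S" and u: "u \<in> rvec d" and v: "v \<in> rvec d"
  shows "\<bar>sinner d S u v\<bar> \<le> snorm d S u * snorm d S v"
proof -
  let ?a = "sinner d S u u" and ?b = "sinner d S u v" and ?c = "sinner d S v v"
  have nonneg: "0 \<le> ?a" "0 \<le> ?c"
    using S u v by (simp_all add: sinner_nonneg)
  have "?b\<^sup>2 \<le> ?a * ?c"
  proof (cases "?c = 0")
    case True
    have "0 \<le> 1\<^sup>2 * ?a + 2 * 1 * t * ?b + t\<^sup>2 * ?c" for t
      by (rule sinner_quadratic_nonneg[OF S])
    \<comment> \<open>If \<open>?c\<close> is 0, the quadratic is affine in \<open>t\<close>. Were
      \<open>?b\<close> nonzero, this \<open>t\<close> would give it the value -1.\<close>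
    from this[of "- (?a + 1) / (2 * ?b)"] True show ?thesis
      by (cases "?b = 0") (auto simp: field_simps)
  next
    case False
    \<comment> \<open>The form at \<open>?c\<close> times \<open>u\<close> minus \<open>?b\<close>
      times \<open>v\<close>, up to a factor the minimizing combination.\<close>
    have "0 \<le> ?c\<^sup>2 * ?a + 2 * ?c * (- ?b) * ?b + (- ?b)\<^sup>2 * ?c"
      by (rule sinner_quadratic_nonneg[OF S])
    also have "\<dots> = ?c * (?a * ?c - ?b\<^sup>2)"
      by (simp add: power2_eq_square algebra_simps)
    finally show ?thesis
      using False nonneg by (simp add: zero_le_mult_iff)
  qed
  then have "sqrt (?b\<^sup>2) \<le> sqrt (?a * ?c)"
    by (rule real_sqrt_le_mono)
  then show ?thesis
    by (simp add: snorm_def real_sqrt_mult)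
qed

lemma sinner_measurable [measurable]:
  "sinner d S u \<in> borel_measurable (rvec_borel d)"
  "(\<lambda>w. sinner d S w w) \<in> borel_measurable (rvec_borel d)"
  unfolding sinner_def by measurable

lemma snorm_measurable [measurable]: "snorm d S \<in> borel_measurable (rvec_borel d)"
  unfolding snorm_def by measurable

lemma dotp_measurable [measurable]:
  assumes [measurable]: "u \<in> N \<rightarrow>\<^sub>M rvec_borel d" "x \<in> N \<rightarrow>\<^sub>M rvec_borel d"
  shows "(\<lambda>y. dotp d (u y) (x y)) \<in> borel_measurable N"
  unfolding dotp_def by measurable

text \<open>If a norm vanishes, the quotient is 0 by the convention for division, so degenerate
  vectors are covered.\<close>

lemma cosine_bound:
  assumes "covariance_matrix d S" "u \<in> rvec d" "w \<in> rvec d"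
  shows "\<bar>sinner d S u w / (snorm d S w * snorm d S u)\<bar> \<le> 1"
proof -
  have "\<bar>sinner d S u w\<bar> \<le> \<bar>snorm d S w * snorm d S u\<bar>"
    using sinner_Cauchy_Schwarz[OF assms] by (simp add: mult.commute)
  then show ?thesis
    by (auto simp: abs_divide divide_le_eq_1)
qed

text \<open>Only the continuity of \<open>arccos\<close> on the interval from -1 to 1 is used. The
  argument is clamped to that interval, which changes nothing on \<open>rvec d\<close> by
  \<open>cosine_bound\<close>.\<close>

lemma sangle_measurable [measurable]:
  assumes S: "covariance_matrix d S" and u: "u \<in> rvec d"
  shows "sangle d S u \<in> borel_measurable (rvec_borel d)"
proof -
  have "(\<lambda>w. arccos (max (-1) (min 1 (sinner d S u w / (snorm d S w * snorm d S u)))))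
      \<in> borel_measurable (rvec_borel d)"
  proof (rule measurable_compose[of _ _ "restrict_space borel {-1..1}" arccos])
    show "arccos \<in> borel_measurable (restrict_space borel {-1..1})"
      by (rule borel_measurable_continuous_on_restrict) (rule continuous_on_arccos')
  qed (auto intro!: measurable_restrict_space2)
  also have "?this \<longleftrightarrow> ?thesis"
  proof (rule measurable_cong)
    fix w assume "w \<in> space (rvec_borel d)"
    then have "\<bar>sinner d S u w / (snorm d S w * snorm d S u)\<bar> \<le> 1"
      by (intro cosine_bound S u) (auto simp: space_PiM)
    then show "arccos (max (-1) (min 1 (sinner d S u w / (snorm d S w * snorm d S u)))) = sangle d S u w"
      unfolding sangle_def abs_le_iff by (intro arg_cong[where f=arccos]) linarith
  qed
  finally show ?thesis .
qed

text \<open>The standard normal characteristic function is evaluated at the frequency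
  \<open>sqrt (sinner d S u u)\<close>; variance 0 is simply frequency 0.\<close>

lemma gaussian_vector_char:
  assumes S: "covariance_matrix d S" and X: "gaussian_vector M d S X" and u: "u \<in> rvec d"
  shows "(CLINT \<omega>|M. iexp (dotp d u (X \<omega>))) = exp (- sinner d S u u / 2)"
proof -
  have [measurable]: "X \<in> M \<rightarrow>\<^sub>M rvec_borel d" and
    law: "distr M borel (\<lambda>\<omega>. dotp d u (X \<omega>)) =
      distr std_normal_distribution borel (\<lambda>z. sqrt (sinner d S u u) * z)"
    using X u by (auto simp: gaussian_vector_def)
  have [measurable]: "(\<lambda>\<omega>. dotp d u (X \<omega>)) \<in> borel_measurable M"
    using u by (intro dotp_measurable) (auto simp: space_PiM)
  have "(CLINT \<omega>|M. iexp (dotp d u (X \<omega>))) = (CLINT t|distr M borel (\<lambda>\<omega>. dotp d u (X \<omega>)). iexp t)"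
    by (subst integral_distr) auto
  also have "\<dots> = char std_normal_distribution (sqrt (sinner d S u u))"
    unfolding law by (subst integral_distr) (auto simp: char_def)
  finally show ?thesis
    using sinner_nonneg[OF S u] by (simp add: char_std_normal_distribution exp_of_real)
qed

text \<open>Orthogonality kills the cross term of the variance of each combination of the two
  functionals, so the joint characteristic function factors.\<close>

lemma gaussian_vector_indep:
  assumes M: "prob_space M" and S: "covariance_matrix d S" and X: "gaussian_vector M d S X"
    and u: "u \<in> rvec d" and v: "v \<in> rvec d" and orth: "sinner d S u v = 0"
  shows "distr M (borel \<Otimes>\<^sub>M borel) (\<lambda>\<omega>. (dotp d u (X \<omega>), dotp d v (X \<omega>))) =
    distr M borel (\<lambda>\<omega>. dotp d u (X \<omega>)) \<Otimes>\<^sub>M distr M borel (\<lambda>\<omega>. dotp d v (X \<omega>))"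
proof -
  interpret prob_space M by fact
  have [measurable]: "X \<in> M \<rightarrow>\<^sub>M rvec_borel d"
    using X by (auto simp: gaussian_vector_def)
  have meas: "(\<lambda>\<omega>. dotp d t (X \<omega>)) \<in> borel_measurable M" if "t \<in> rvec d" for t
    using that by (intro dotp_measurable) (auto simp: space_PiM)
  have char2: "(CLINT \<omega>|M. iexp (a * dotp d u (X \<omega>) + b * dotp d v (X \<omega>))) =
      exp (- (a\<^sup>2 * sinner d S u u + b\<^sup>2 * sinner d S v v) / 2)" for a b
    using gaussian_vector_char[OF S X, of "\<lambda>i\<in>{..<d}. a * u i + b * v i"]
    by (simp add: dotp_linear sinner_quadratic[OF S] orth)
  show ?thesis
  proof (rule distr_pair_eq_char)
    show "(CLINT \<omega>|M. iexp (a * dotp d u (X \<omega>) + b * dotp d v (X \<omega>))) =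
      (CLINT \<omega>|M. iexp (a * dotp d u (X \<omega>))) * (CLINT \<omega>|M. iexp (b * dotp d v (X \<omega>)))" for a b
      \<comment> \<open>The instances with one coefficient 0 are the marginals.\<close>
      using char2[of a b] char2[of a 0] char2[of 0 b]
      by (simp add: exp_add[symmetric] of_real_mult[symmetric] diff_divide_distrib del: of_real_mult)
  qed (use u v meas in auto)
qed

section \<open>The angular predictor as a measurable function with values in the unit
  interval\<close>

lemma prob_space_std_normal: "prob_space std_normal_distribution"
  by (simp add: prob_space_normal_density)

lemma f_ang_measurable [measurable (raw)]:
  assumes [measurable]: "\<sigma> \<in> borel_measurable borel" "r \<in> borel_measurable N"
    "\<theta> \<in> borel_measurable N" "u \<in> borel_measurable N"
  shows "(\<lambda>x. f_ang \<sigma> (r x) (\<theta> x) (u x)) \<in> borel_measurable N"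
proof -
  interpret prob_space std_normal_distribution by (rule prob_space_std_normal)
  show ?thesis
    unfolding f_ang_def by measurable
qed

lemma link_integrable:
  assumes [measurable]: "\<sigma> \<in> borel_measurable borel" and range: "\<And>t. \<sigma> t \<in> {0..1::real}"
  shows "integrable std_normal_distribution (\<lambda>z. \<sigma> (a + b * z))"
proof -
  interpret prob_space std_normal_distribution by (rule prob_space_std_normal)
  show ?thesis
    by (rule integrable_const_bound[where B=1]) (use range in auto)
qed

lemma f_ang_range:
  assumes [measurable]: "\<sigma> \<in> borel_measurable borel" and range: "\<And>t. \<sigma> t \<in> {0..1}"
  shows "f_ang \<sigma> r \<theta> u \<in> {0..1}"
proof -
  interpret prob_space std_normal_distribution by (rule prob_space_std_normal)
  have "f_ang \<sigma> r \<theta> u \<le> (\<integral>z. 1 \<partial>std_normal_distribution)"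
    unfolding f_ang_def using range by (intro integral_mono link_integrable) auto
  moreover have "0 \<le> f_ang \<sigma> r \<theta> u"
    unfolding f_ang_def using range by (intro integral_nonneg_AE) auto
  ultimately show ?thesis using prob_space by simp
qed

lemma f_ang_predictor:
  assumes "\<sigma> \<in> borel_measurable borel" and "\<And>t. \<sigma> t \<in> {0..1}"
  shows "f_ang \<sigma> r \<theta> \<in> predictors"
  unfolding predictors_def by (intro CollectI conjI allI f_ang_range f_ang_measurable assms) simp_all

text \<open>
  Writing \<open>r\<close> for the norm of \<open>w\<close> and \<open>c\<close> for the cosine of its angle with \<open>wstar\<close>, the residual
  \<open>v = wstar - (c / r) w\<close> is orthogonal to \<open>w\<close> and has variance \<open>1 - c\<^sup>2\<close>. For \<open>r = 0\<close> the conventions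
  \<open>x / 0 = 0\<close> and \<open>arccos 0 = pi / 2\<close> give \<open>v = wstar\<close>, and the identity still holds.
\<close>
lemma gaussian_conditional_mean:
  assumes M: "prob_space M" and S: "covariance_matrix d S" and X: "gaussian_vector M d S X"
    and wstar: "wstar \<in> rvec d" and wstar_norm: "snorm d S wstar = 1" and w: "w \<in> rvec d"
    and [measurable]: "\<sigma> \<in> borel_measurable borel" and range: "\<And>t. \<sigma> t \<in> {0..1}"
    and [measurable]: "h \<in> borel_measurable borel" and h_bound: "\<And>u. \<bar>h u\<bar> \<le> C"
  shows "(LINT \<omega>|M. \<sigma> (dotp d wstar (X \<omega>)) * h (dotp d w (X \<omega>))) =
    (LINT \<omega>|M. f_ang \<sigma> (snorm d S w) (sangle d S wstar w) (dotp d w (X \<omega>)) * h (dotp d w (X \<omega>)))"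
proof -
  interpret prob_space M by fact
  define r where "r = snorm d S w"
  define c where "c = sinner d S wstar w / r"
  define \<theta> where "\<theta> = sangle d S wstar w"
  define v where "v = (\<lambda>i\<in>{..<d}. 1 * wstar i + (- (c / r)) * w i)"
  have v: "v \<in> rvec d" by (simp add: v_def)
  have v_dotp: "dotp d v x = dotp d wstar x - c / r * dotp d w x" for x
    unfolding v_def dotp_restrict dotp_linear by simp
  have c_le: "\<bar>c\<bar> \<le> 1"
    using cosine_bound[OF S wstar w] by (simp add: c_def r_def wstar_norm)
  \<comment> \<open>For \<open>r = 0\<close> Cauchy-Schwarz forces the inner product to be 0, so the
    equation survives the division by zero in \<open>c\<close>.\<close>
  have c_eq: "c * r = sinner d S wstar w"
    using sinner_Cauchy_Schwarz[OF S wstar w] by (auto simp: c_def r_def wstar_norm)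
  have \<theta>: "cos \<theta> = c" "sin \<theta> = sqrt (1 - c\<^sup>2)"
    using c_le unfolding \<theta>_def sangle_def wstar_norm r_def[symmetric]
    by (simp_all add: c_def[symmetric] cos_arccos_abs sin_arccos_abs)
  have wstar1: "sinner d S wstar wstar = 1" and ww: "sinner d S w w = r\<^sup>2"
    using snorm_power2[OF S wstar] snorm_power2[OF S w] by (simp_all add: wstar_norm r_def)
  have orth: "sinner d S w v = 0"
    unfolding v_def sinner_restrict sinner_linear ww sinner_commute[OF S, of w wstar] c_eq[symmetric]
    by (simp add: power2_eq_square)
  have vv: "sinner d S v v = 1 - c\<^sup>2"
  proof (cases "r = 0")
    case True
    then have "c = 0" by (simp add: c_def)
    with True show ?thesis
      unfolding v_def sinner_restrict sinner_quadratic[OF S] by (simp add: wstar1)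
  next
    case False
    then show ?thesis
      unfolding v_def sinner_restrict sinner_quadratic[OF S] wstar1 ww c_eq[symmetric]
      by (simp add: power2_eq_square field_simps)
  qed
  \<comment> \<open>The residual has variance \<open>1 - c\<^sup>2\<close>, whose root is
    \<open>sin \<theta>\<close>, so its law is that of the noise term in
    \<open>f_ang\<close>.\<close>
  have [measurable]: "X \<in> M \<rightarrow>\<^sub>M rvec_borel d" and
    v_law: "distr M borel (\<lambda>\<omega>. dotp d v (X \<omega>)) = distr std_normal_distribution borel (\<lambda>z. sin \<theta> * z)"
    using X v by (auto simp: gaussian_vector_def vv \<theta>)
  have meas: "(\<lambda>\<omega>. dotp d t (X \<omega>)) \<in> borel_measurable M" if "t \<in> rvec d" for t
    using that by (intro dotp_measurable) (auto simp: space_PiM)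
  note [measurable] = meas[OF v] meas[OF w] meas[OF wstar]
  let ?U = "distr M borel (\<lambda>\<omega>. dotp d w (X \<omega>))" and ?V = "distr M borel (\<lambda>\<omega>. dotp d v (X \<omega>))"
  interpret U: prob_space ?U by (rule prob_space_distr) simp
  interpret V: prob_space ?V by (rule prob_space_distr) simp
  interpret UV: pair_prob_space ?U ?V ..
  \<comment> \<open>The integrand in the independent coordinates, score \<open>u\<close> and
    residual \<open>v\<close>. Integrating \<open>v\<close> out for fixed \<open>u\<close> leaves
    the angular predictor.\<close>
  define k where "k = (\<lambda>(u, v). \<sigma> (c * (u / r) + v) * h u)"
  have k_meas [measurable]: "k \<in> borel_measurable (borel \<Otimes>\<^sub>M borel)"
    unfolding k_def by measurable
  have "integrable (?U \<Otimes>\<^sub>M ?V) k"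
  proof (rule UV.integrable_const_bound[where B="1 * C"])
    have "\<bar>\<sigma> s\<bar> * \<bar>h t\<bar> \<le> 1 * C" for s t
      using range h_bound by (intro mult_mono) auto
    then show "AE p in ?U \<Otimes>\<^sub>M ?V. norm (k p) \<le> 1 * C"
      unfolding k_def real_norm_def by (intro AE_I2) (auto simp: abs_mult split: prod.split)
  qed (use k_meas in \<open>simp cong: measurable_cong_sets\<close>)
  have "(LINT \<omega>|M. \<sigma> (dotp d wstar (X \<omega>)) * h (dotp d w (X \<omega>))) = (LINT \<omega>|M. k (dotp d w (X \<omega>), dotp d v (X \<omega>)))"
    by (simp add: k_def v_dotp)
  also have "\<dots> = (LINT p|distr M (borel \<Otimes>\<^sub>M borel) (\<lambda>\<omega>. (dotp d w (X \<omega>), dotp d v (X \<omega>))). k p)"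
    by (subst integral_distr) auto
  also have "\<dots> = (LINT p|(?U \<Otimes>\<^sub>M ?V). k p)"
    by (simp add: gaussian_vector_indep[OF M S X w v orth])
  also have "\<dots> = (LINT u|?U. LINT v|?V. k (u, v))"
    by (rule UV.integral_fst'[symmetric]) fact
  also have "\<dots> = (LINT u|?U. f_ang \<sigma> r \<theta> u * h u)"
  proof (rule Bochner_Integration.integral_cong)
    fix u
    have "(LINT v|?V. k (u, v)) = (LINT z|std_normal_distribution. \<sigma> (c * (u / r) + sin \<theta> * z) * h u)"
      unfolding v_law k_def by (subst integral_distr) auto
    also have "\<dots> = f_ang \<sigma> r \<theta> u * h u"
      by (simp add: f_ang_def \<theta>(1))
    finally show "(LINT v|?V. k (u, v)) = f_ang \<sigma> r \<theta> u * h u" .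
  qed simp
  also have "\<dots> = (LINT \<omega>|M. f_ang \<sigma> r \<theta> (dotp d w (X \<omega>)) * h (dotp d w (X \<omega>)))"
    by (subst integral_distr) auto
  finally show ?thesis
    by (simp add: r_def \<theta>_def)
qed

subsection \<open>Bregman losses on probability vectors\<close>

text \<open>\<open>gradient\<close> is a definite description, so a representing vector must exist
  and be unique. The derivative is represented by its values on the basis; the difference of two
  representing vectors is orthogonal to itself.\<close>

lemma GDERIV_gradient:
  fixes f :: "'v::euclidean_space \<Rightarrow> real"
  assumes "f differentiable (at x)"
  shows "GDERIV f x :> gradient f x"
proof -
  obtain f' where f': "(f has_derivative f') (at x)"
    using assms by (auto simp: differentiable_def)
  then interpret bounded_linear f' by (rule has_derivative_bounded_linear)
  have "f' = (\<lambda>h. inner h (\<Sum>b\<in>Basis. f' b *\<^sub>R b))"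
  proof
    fix h
    have "f' h = f' (\<Sum>b\<in>Basis. inner h b *\<^sub>R b)"
      by (simp add: euclidean_representation)
    also have "\<dots> = inner h (\<Sum>b\<in>Basis. f' b *\<^sub>R b)"
      by (simp add: sum scaleR inner_sum_right mult.commute)
    finally show "f' h = inner h (\<Sum>b\<in>Basis. f' b *\<^sub>R b)" .
  qed
  with f' have ex: "GDERIV f x :> (\<Sum>b\<in>Basis. f' b *\<^sub>R b)"
    unfolding gderiv_def by (simp only:)
  have "D = D'" if "GDERIV f x :> D" "GDERIV f x :> D'" for D D'
  proof -
    have "(\<lambda>h. inner h D) = (\<lambda>h. inner h D')"
      using that unfolding gderiv_def by (rule has_derivative_unique)
    then have "inner (D - D') (D - D') = 0"
      by (metis inner_diff_right right_minus_eq)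
    then show ?thesis by simp
  qed
  with ex show ?thesis
    unfolding gradient_def by (intro theI[of "\<lambda>D. GDERIV f x :> D"]) blast+
qed

text \<open>The tangent inequality along the segment is used at the midpoint rather than at
  \<open>x\<close>. There strict convexity puts the function strictly below the chord, and this
  makes the bound at \<open>x\<close> strict.\<close>

lemma bregman_pos:
  fixes f :: "'v::euclidean_space \<Rightarrow> real"
  assumes convex: "strictly_convex f" and diff: "f differentiable (at y)" and "x \<noteq> y"
  shows "0 < bregman f x y"
proof -
  define g where "g t = f (y + t *\<^sub>R (x - y))" for t
  have D: "(g has_real_derivative inner (x - y) (gradient f y)) (at 0)"
  proof -
    have "((\<lambda>t. y + t *\<^sub>R (x - y)) has_derivative (\<lambda>t. t *\<^sub>R (x - y))) (at 0)"
      by (auto intro!: derivative_eq_intros)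
    moreover have "(f has_derivative (\<lambda>h. inner h (gradient f y))) (at (y + 0 *\<^sub>R (x - y)))"
      using GDERIV_gradient[OF diff] by (simp add: gderiv_def)
    ultimately have "(g has_derivative (\<lambda>t. inner (t *\<^sub>R (x - y)) (gradient f y))) (at 0)"
      unfolding g_def by (rule has_derivative_compose)
    moreover have "(\<lambda>t. inner (t *\<^sub>R (x - y)) (gradient f y)) = (*) (inner (x - y) (gradient f y))"
      by (auto simp: fun_eq_iff)
    ultimately show ?thesis
      by (simp add: has_field_derivative_def)
  qed
  have lt: "f ((1 - t) *\<^sub>R a + t *\<^sub>R b) < (1 - t) * f a + t * f b" if "a \<noteq> b" "0 < t" "t < 1" for a b t
    using convex that unfolding strictly_convex_def by blast
  have "convex_on UNIV g"
  proof (rule convex_onI)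
    fix t a b :: real assume t: "0 < t" "t < 1"
    have line: "y + ((1 - t) *\<^sub>R a + t *\<^sub>R b) *\<^sub>R (x - y) =
        (1 - t) *\<^sub>R (y + a *\<^sub>R (x - y)) + t *\<^sub>R (y + b *\<^sub>R (x - y))"
      by (simp add: algebra_simps)
    show "g ((1 - t) *\<^sub>R a + t *\<^sub>R b) \<le> (1 - t) * g a + t * g b"
    proof (cases "a = b")
      case True then show ?thesis by (simp add: algebra_simps)
    next
      case False
      then show ?thesis
        unfolding g_def line using lt[OF _ t] \<open>x \<noteq> y\<close> by (simp add: less_imp_le)
    qed
  qed simp
  then have "inner (x - y) (gradient f y) * (1/2 - 0) \<le> g (1/2) - g 0"
    by (rule convex_on_imp_above_tangent) (use D in \<open>auto simp: connected_UNIV\<close>)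
  moreover have "g (1/2) < (f y + f x) / 2"
  proof -
    have "y + (1/2) *\<^sub>R (x - y) = (1 - 1/2) *\<^sub>R y + (1/2) *\<^sub>R x"
      by (simp add: algebra_simps) (metis scaleR_add_left scaleR_one field_sum_of_halves)
    then show ?thesis
      using lt[of y x "1/2"] \<open>x \<noteq> y\<close> by (simp add: g_def)
  qed
  ultimately show ?thesis
    by (simp add: bregman_def g_def)
qed

lemma bregman_self [simp]: "bregman f x x = 0"
  by (simp add: bregman_def)

lemma bregman_nonneg:
  fixes f :: "'v::euclidean_space \<Rightarrow> real"
  assumes "strictly_convex f" "f differentiable (at y)"
  shows "0 \<le> bregman f x y"
  using bregman_pos[OF assms, of x] by (cases "x = y") auto

section \<open>The segment of probability vectors\<close>

lemma prob_vec_diff: "prob_vec p - prob_vec q = (p - q) *\<^sub>R vector [1, -1]"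
  by (simp add: prob_vec_def vec_eq_iff forall_2)

lemma prob_vec_eq_iff [simp]: "prob_vec p = prob_vec q \<longleftrightarrow> p = q"
  by (auto simp: prob_vec_def vec_eq_iff forall_2)

lemma norm_prob_vec_diff: "(norm (prob_vec p - prob_vec q))\<^sup>2 = 2 * (p - q)\<^sup>2"
  by (simp add: prob_vec_diff power_mult_distrib power2_norm_eq_inner inner_vec_def sum_2)

text \<open>The derivative of \<open>f\<close> along the segment: \<open>prob_vec\<close> moves in
  the direction (1, -1).\<close>

definition line_slope :: "(real ^ 2 \<Rightarrow> real) \<Rightarrow> real \<Rightarrow> real" where
  "line_slope f q = inner (vector [1, -1]) (gradient f (prob_vec q))"

lemma bregman_prob_vec:
  "bregman f (prob_vec p) (prob_vec q) = f (prob_vec p) - f (prob_vec q) - (p - q) * line_slope f q"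
  by (simp add: bregman_def prob_vec_diff line_slope_def)

lemma isCont_prob_vec: "isCont prob_vec p"
proof -
  have eq: "prob_vec = (\<lambda>p. vector [0, 1] + p *\<^sub>R vector [1, -1])"
    by (auto simp: fun_eq_iff prob_vec_def vec_eq_iff forall_2)
  show ?thesis
    unfolding eq by (intro continuous_intros)
qed

context
  fixes f :: "real ^ 2 \<Rightarrow> real"
  assumes convex: "strictly_convex f" and diff: "\<And>q. f differentiable (at q)"
begin

text \<open>The losses of two points against each other, in both orders, add up to the product of
  the increments of argument and slope. Monotonicity then yields both measurability of the slope and
  its boundedness by the endpoint values.\<close>

lemma mono_line_slope: "mono (line_slope f)"
proof (rule monoI)
  fix p q :: real assume "p \<le> q"
  have "0 \<le> bregman f (prob_vec p) (prob_vec q) + bregman f (prob_vec q) (prob_vec p)"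
    by (intro add_nonneg_nonneg bregman_nonneg convex diff)
  then have "0 \<le> (q - p) * (line_slope f q - line_slope f p)"
    by (simp add: bregman_prob_vec algebra_simps)
  with \<open>p \<le> q\<close> show "line_slope f p \<le> line_slope f q"
    by (cases "p = q") (auto simp: zero_le_mult_iff)
qed

lemma line_slope_measurable [measurable]: "line_slope f \<in> borel_measurable borel"
  by (rule borel_measurable_mono[OF mono_line_slope])

lemma isCont_line: "isCont (\<lambda>p. f (prob_vec p)) p"
  using isCont_o2[OF isCont_prob_vec differentiable_imp_continuous_within[OF diff]] .

lemma line_measurable [measurable]: "(\<lambda>p. f (prob_vec p)) \<in> borel_measurable borel"
  by (intro borel_measurable_continuous_onI continuous_at_imp_continuous_on ballI isCont_line)

lemma line_slope_bounded: "\<exists>C. \<forall>q\<in>{0..1}. \<bar>line_slope f q\<bar> \<le> C"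
proof (intro exI ballI)
  fix q :: real assume "q \<in> {0..1}"
  then have "line_slope f 0 \<le> line_slope f q" "line_slope f q \<le> line_slope f 1"
    using monoD[OF mono_line_slope] by auto
  then show "\<bar>line_slope f q\<bar> \<le> \<bar>line_slope f 0\<bar> + \<bar>line_slope f 1\<bar>"
    by linarith
qed

lemma line_bounded: "\<exists>C. \<forall>q\<in>{0..1}. \<bar>f (prob_vec q)\<bar> \<le> C"
proof -
  have "bounded ((\<lambda>q. f (prob_vec q)) ` {0..1})"
    by (intro compact_imp_bounded compact_continuous_image continuous_at_imp_continuous_on ballI isCont_line compact_Icc)
  then show ?thesis
    by (auto simp: bounded_iff)
qed

text \<open>Makes the risks finite, so that they can be computed as Lebesgue integrals and
  cancelled.\<close>

lemma bregman_line_bounded: "\<exists>C. \<forall>p\<in>{0..1}. \<forall>q\<in>{0..1}. bregman f (prob_vec p) (prob_vec q) \<le> C"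
proof -
  obtain B C where B: "\<And>q. q \<in> {0..1} \<Longrightarrow> \<bar>f (prob_vec q)\<bar> \<le> B"
    and C: "\<And>q. q \<in> {0..1} \<Longrightarrow> \<bar>line_slope f q\<bar> \<le> C"
    using line_bounded line_slope_bounded by metis
  have "bregman f (prob_vec p) (prob_vec q) \<le> B + B + 1 * C" if "p \<in> {0..1}" "q \<in> {0..1}" for p q
  proof -
    have "\<bar>(p - q) * line_slope f q\<bar> \<le> 1 * C"
      unfolding abs_mult using that C[OF that(2)] by (intro mult_mono) auto
    then show ?thesis
      using B[OF that(1)] B[OF that(2)] by (auto simp: bregman_prob_vec)
  qed
  then show ?thesis by blast
qed

lemma bregman_line_measurable [measurable]:
  "(\<lambda>(p, q). bregman f (prob_vec p) (prob_vec q)) \<in> borel_measurable (borel \<Otimes>\<^sub>M borel)"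
  unfolding bregman_prob_vec by measurable

text \<open>The last assumption expresses \<open>F(T) = E[p | T]\<close>.\<close>
lemma bregman_pythagoras:
  fixes N :: "'b measure" and p T :: "'b \<Rightarrow> real" and F G :: "real \<Rightarrow> real"
  assumes "prob_space N"
    and [measurable]: "p \<in> borel_measurable N" "T \<in> borel_measurable N"
    and p01: "\<And>x. p x \<in> {0..1}" and F: "F \<in> predictors" and G: "G \<in> predictors"
    and cond: "\<And>h C. h \<in> borel_measurable borel \<Longrightarrow> (\<And>u. \<bar>h u\<bar> \<le> C) \<Longrightarrow>
      (LINT x|N. p x * h (T x)) = (LINT x|N. F (T x) * h (T x))"
  shows "(\<integral>\<^sup>+x. bregman f (prob_vec (p x)) (prob_vec (G (T x))) \<partial>N) =
    (\<integral>\<^sup>+x. bregman f (prob_vec (p x)) (prob_vec (F (T x))) \<partial>N) +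
    (\<integral>\<^sup>+x. bregman f (prob_vec (F (T x))) (prob_vec (G (T x))) \<partial>N)"
proof -
  interpret prob_space N by fact
  have [measurable]: "F \<in> borel_measurable borel" "G \<in> borel_measurable borel"
    and F01: "\<And>u. F u \<in> {0..1}" and G01: "\<And>u. G u \<in> {0..1}"
    using F G by (auto simp: predictors_def)
  obtain B C where B: "\<And>p q. p \<in> {0..1} \<Longrightarrow> q \<in> {0..1} \<Longrightarrow> bregman f (prob_vec p) (prob_vec q) \<le> B"
    and C: "\<And>q. q \<in> {0..1} \<Longrightarrow> \<bar>line_slope f q\<bar> \<le> C"
    using bregman_line_bounded line_slope_bounded by metis
  let ?D = "\<lambda>p q. bregman f (prob_vec p) (prob_vec q)"
  have nonneg: "0 \<le> ?D p q" for p q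
    by (rule bregman_nonneg[OF convex diff])
  have int_D: "integrable N (\<lambda>x. ?D (a x) (b x))"
    if [measurable]: "a \<in> borel_measurable N" "b \<in> borel_measurable N"
      and "\<And>x. a x \<in> {0..1}" "\<And>x. b x \<in> {0..1}" for a b
    by (rule integrable_const_bound[where B=B]) (use that(3,4) B nonneg in auto)
  \<comment> \<open>Expanding shows that the loss of \<open>p\<close> against \<open>G\<close>
    exceeds the sum of the other two losses by \<open>(p - F) * h\<close>. As \<open>h\<close> is
    bounded and depends on the score only, \<open>cond\<close> makes this term vanish on
    average.\<close>
  define h where "h u = line_slope f (F u) - line_slope f (G u)" for u
  have [measurable]: "h \<in> borel_measurable borel" unfolding h_def by measurable
  have h_bound: "\<bar>h u\<bar> \<le> 2 * C" for u
    using C[OF F01, of u] C[OF G01, of u] by (simp add: h_def)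
  have int_h: "integrable N (\<lambda>x. a x * h (T x))"
    if [measurable]: "a \<in> borel_measurable N" and "\<And>x. a x \<in> {0..1}" for a
  proof (rule integrable_const_bound[where B="1 * (2 * C)"])
    show "AE x in N. norm (a x * h (T x)) \<le> 1 * (2 * C)"
      unfolding real_norm_def abs_mult using that(2) h_bound by (intro AE_I2 mult_mono) auto
  qed auto
  have "(LINT x|N. ?D (p x) (G (T x))) =
      (LINT x|N. ?D (p x) (F (T x)) + ?D (F (T x)) (G (T x)) + (p x * h (T x) - F (T x) * h (T x)))"
    by (rule Bochner_Integration.integral_cong) (auto simp: bregman_prob_vec h_def algebra_simps)
  also have "\<dots> = (LINT x|N. ?D (p x) (F (T x))) + (LINT x|N. ?D (F (T x)) (G (T x)))
      + ((LINT x|N. p x * h (T x)) - (LINT x|N. F (T x) * h (T x)))"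
    using p01 F01 G01 by (simp add: int_D int_h)
  also have "\<dots> = (LINT x|N. ?D (p x) (F (T x))) + (LINT x|N. ?D (F (T x)) (G (T x)))"
    by (simp add: cond[of h "2 * C", OF _ h_bound])
  finally show ?thesis
    using p01 F01 G01
    by (simp add: nn_integral_eq_integral int_D nonneg ennreal_plus[symmetric] integral_nonneg del: ennreal_plus)
qed

text \<open>The excess risk of \<open>G\<close> over \<open>F\<close> is the expected loss of
  \<open>F\<close> against \<open>G\<close>, and \<open>bregman_pos\<close> makes that loss positive
  wherever the two differ.\<close>

lemma bregman_arg_min_iff:
  fixes N :: "'b measure" and p T :: "'b \<Rightarrow> real" and F :: "real \<Rightarrow> real"
  assumes N: "prob_space N"
    and [measurable]: "p \<in> borel_measurable N" "T \<in> borel_measurable N"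
    and p01: "\<And>x. p x \<in> {0..1}" and F: "F \<in> predictors"
    and cond: "\<And>h C. h \<in> borel_measurable borel \<Longrightarrow> (\<And>u. \<bar>h u\<bar> \<le> C) \<Longrightarrow>
      (LINT x|N. p x * h (T x)) = (LINT x|N. F (T x) * h (T x))"
  shows "is_arg_min (\<lambda>G. \<integral>\<^sup>+x. bregman f (prob_vec (p x)) (prob_vec (G (T x))) \<partial>N) (\<lambda>G. G \<in> predictors) G
    \<longleftrightarrow> G \<in> predictors \<and> (AE x in N. G (T x) = F (T x))"
proof -
  interpret prob_space N by fact
  let ?R = "\<lambda>G. \<integral>\<^sup>+x. bregman f (prob_vec (p x)) (prob_vec (G (T x))) \<partial>N"
  let ?E = "\<lambda>G. \<integral>\<^sup>+x. bregman f (prob_vec (F (T x))) (prob_vec (G (T x))) \<partial>N"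
  have [measurable]: "F \<in> borel_measurable borel" and F01: "\<And>u. F u \<in> {0..1}"
    using F by (auto simp: predictors_def)
  have pyth: "?R G = ?R F + ?E G" if "G \<in> predictors" for G
    by (rule bregman_pythagoras[OF N _ _ p01 F that cond]) auto
  obtain B where B: "\<And>p q. p \<in> {0..1} \<Longrightarrow> q \<in> {0..1} \<Longrightarrow> bregman f (prob_vec p) (prob_vec q) \<le> B"
    using bregman_line_bounded by metis
  have "?R F \<le> (\<integral>\<^sup>+x. ennreal B \<partial>N)"
    by (intro nn_integral_mono ennreal_leI B p01 F01)
  \<comment> \<open>Needed below to cancel the risk of \<open>F\<close> in the extended
    reals.\<close>
  then have fin: "?R F \<noteq> \<infinity>"
    by (auto simp: emeasure_space_1 top_unique)
  have E0: "?E G = 0 \<longleftrightarrow> (AE x in N. G (T x) = F (T x))" if G: "G \<in> predictors" for G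
  proof -
    have [measurable]: "G \<in> borel_measurable borel" using G by (auto simp: predictors_def)
    have "?E G = 0 \<longleftrightarrow> (AE x in N. ennreal (bregman f (prob_vec (F (T x))) (prob_vec (G (T x)))) = 0)"
      by (rule nn_integral_0_iff_AE) measurable
    also have "\<dots> \<longleftrightarrow> (AE x in N. G (T x) = F (T x))"
    proof (intro AE_cong)
      fix x
      show "(ennreal (bregman f (prob_vec (F (T x))) (prob_vec (G (T x)))) = 0) \<longleftrightarrow> G (T x) = F (T x)"
        using bregman_pos[OF convex diff, of "prob_vec (F (T x))" "prob_vec (G (T x))"]
        by (cases "G (T x) = F (T x)") (auto simp: ennreal_eq_0_iff)
    qed
    finally show ?thesis .
  qed
  show ?thesis
  proof (cases "G \<in> predictors")
    case G: True
    have "is_arg_min ?R (\<lambda>G. G \<in> predictors) G \<longleftrightarrow> (\<forall>G'\<in>predictors. ?R G \<le> ?R G')"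
      using G by (auto simp: is_arg_min_linorder)
    \<comment> \<open>Since \<open>F\<close> is already optimal, comparison with \<open>F\<close>
      alone decides minimality.\<close>
    also have "\<dots> \<longleftrightarrow> ?R G \<le> ?R F"
    proof
      assume le: "?R G \<le> ?R F"
      show "\<forall>G'\<in>predictors. ?R G \<le> ?R G'"
      proof
        fix G' assume "G' \<in> predictors"
        then have "?R F \<le> ?R G'" by (simp only: pyth) (rule add_increasing2; simp)
        with le show "?R G \<le> ?R G'" by (rule order_trans)
      qed
    qed (use F in blast)
    also have "\<dots> \<longleftrightarrow> ?R F + ?E G \<le> ?R F + 0"
      by (simp only: pyth[OF G] add_0_right)
    also have "\<dots> \<longleftrightarrow> ?E G = 0"
      using fin by (simp only: ennreal_add_left_cancel_le) simp
    finally show ?thesis using E0[OF G] G by simp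
  qed (simp add: is_arg_min_def)
qed

end

subsection \<open>Independence of the new point and tightness\<close>

text \<open>The sigma-algebra generated by a function of \<open>X\<close> lies inside that of
  \<open>X\<close>. It carries independence from the observed data over to the estimated
  weights.\<close>

lemma indep_elements_compose:
  assumes M: "prob_space M" and indep: "indep_elements M A X B Y" and f: "f \<in> A \<rightarrow>\<^sub>M C"
  shows "indep_elements M C (\<lambda>\<omega>. f (X \<omega>)) B Y"
proof -
  interpret prob_space M by fact
  have X: "X \<in> M \<rightarrow>\<^sub>M A" and Y: "Y \<in> M \<rightarrow>\<^sub>M B"
    and ind: "indep_set (sets (vimage_algebra (space M) X A)) (sets (vimage_algebra (space M) Y B))"
    using indep by (auto simp: indep_elements_def)
  have fX: "(\<lambda>\<omega>. f (X \<omega>)) \<in> M \<rightarrow>\<^sub>M C"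
    using X f by (rule measurable_compose)
  have "sets (vimage_algebra (space M) (\<lambda>\<omega>. f (X \<omega>)) C) \<subseteq> sets (vimage_algebra (space M) X A)"
  proof
    fix S assume "S \<in> sets (vimage_algebra (space M) (\<lambda>\<omega>. f (X \<omega>)) C)"
    then obtain T where T: "T \<in> sets C" "S = (\<lambda>\<omega>. f (X \<omega>)) -` T \<inter> space M"
      using measurable_space[OF fX] by (auto simp: sets_vimage_algebra2)
    then have S: "S = X -` (f -` T \<inter> space A) \<inter> space M"
      using measurable_space[OF X] by auto
    show "S \<in> sets (vimage_algebra (space M) X A)"
      unfolding S by (rule in_vimage_algebra[OF measurable_sets[OF f T(1)]])
  qed
  then have "indep_set (sets (vimage_algebra (space M) (\<lambda>\<omega>. f (X \<omega>)) C)) (sets (vimage_algebra (space M) Y B))"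
    using ind by (auto simp: indep_sets2_eq)
  with fX Y show ?thesis
    by (simp add: indep_elements_def)
qed

lemma indep_elements_distr:
  assumes M: "prob_space M" and indep: "indep_elements M A X B Y"
  shows "distr M (A \<Otimes>\<^sub>M B) (\<lambda>\<omega>. (X \<omega>, Y \<omega>)) = distr M A X \<Otimes>\<^sub>M distr M B Y"
proof -
  interpret prob_space M by fact
  have [measurable]: "X \<in> M \<rightarrow>\<^sub>M A" "Y \<in> M \<rightarrow>\<^sub>M B"
    and ind: "indep_set (sets (vimage_algebra (space M) X A)) (sets (vimage_algebra (space M) Y B))"
    using indep by (auto simp: indep_elements_def)
  interpret X: prob_space "distr M A X" by (rule prob_space_distr) simp
  interpret Y: prob_space "distr M B Y" by (rule prob_space_distr) simp
  show ?thesis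
  proof (rule pair_measure_eqI[symmetric])
    fix S T assume "S \<in> sets (distr M A X)" "T \<in> sets (distr M B Y)"
    then have [measurable]: "S \<in> sets A" "T \<in> sets B" by auto
    have "prob ((X -` S \<inter> space M) \<inter> (Y -` T \<inter> space M)) = prob (X -` S \<inter> space M) * prob (Y -` T \<inter> space M)"
      by (rule indep_setD[OF ind]) (auto intro: in_vimage_algebra)
    moreover have "(\<lambda>\<omega>. (X \<omega>, Y \<omega>)) -` (S \<times> T) \<inter> space M = (X -` S \<inter> space M) \<inter> (Y -` T \<inter> space M)"
      by auto
    ultimately show "emeasure (distr M A X) S * emeasure (distr M B Y) T =
        emeasure (distr M (A \<Otimes>\<^sub>M B) (\<lambda>\<omega>. (X \<omega>, Y \<omega>))) (S \<times> T)"
      by (simp add: emeasure_distr emeasure_eq_measure ennreal_mult)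
  qed (simp_all add: X.sigma_finite_measure_axioms Y.sigma_finite_measure_axioms cong: sets_pair_measure_cong)
qed

text \<open>Fubini for the product law: \<open>X\<close> is frozen while \<open>Y\<close> keeps its
  distribution. This transfers statements about fixed weights to random ones.\<close>

lemma indep_elements_emeasure:
  assumes M: "prob_space M" and indep: "indep_elements M A X B Y"
    and P [measurable]: "Measurable.pred (A \<Otimes>\<^sub>M B) (\<lambda>(x, y). P x y)"
  shows "emeasure M {\<omega> \<in> space M. P (X \<omega>) (Y \<omega>)} =
    (\<integral>\<^sup>+\<omega>. emeasure (distr M B Y) {y \<in> space B. P (X \<omega>) y} \<partial>M)"
proof -
  interpret prob_space M by fact
  have [measurable]: "X \<in> M \<rightarrow>\<^sub>M A" "Y \<in> M \<rightarrow>\<^sub>M B"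
    using indep by (auto simp: indep_elements_def)
  interpret Y: prob_space "distr M B Y" by (rule prob_space_distr) simp
  define N where "N = {p \<in> space (A \<Otimes>\<^sub>M B). case p of (x, y) \<Rightarrow> P x y}"
  have N [measurable]: "N \<in> sets (A \<Otimes>\<^sub>M B)"
    unfolding N_def using P by (simp add: pred_def)
  have XY: "X \<omega> \<in> space A" "Y \<omega> \<in> space B" if "\<omega> \<in> space M" for \<omega>
    using that by (auto intro: measurable_space)
  have "emeasure M {\<omega> \<in> space M. P (X \<omega>) (Y \<omega>)} = emeasure (distr M (A \<Otimes>\<^sub>M B) (\<lambda>\<omega>. (X \<omega>, Y \<omega>))) N"
    using XY by (subst emeasure_distr) (auto simp: N_def space_pair_measure intro!: arg_cong[where f="emeasure M"])
  also have "\<dots> = (\<integral>\<^sup>+x. emeasure (distr M B Y) (Pair x -` N) \<partial>distr M A X)"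
    unfolding indep_elements_distr[OF M indep] by (rule Y.emeasure_pair_measure_alt) (simp cong: sets_pair_measure_cong)
  also have "\<dots> = (\<integral>\<^sup>+\<omega>. emeasure (distr M B Y) (Pair (X \<omega>) -` N) \<partial>M)"
  proof -
    have "(\<lambda>x. emeasure (distr M B Y) (Pair x -` N)) \<in> borel_measurable A"
      by (rule Y.measurable_emeasure_Pair) (simp cong: sets_pair_measure_cong)
    then show ?thesis
      by (intro nn_integral_distr) simp_all
  qed
  also have "\<dots> = (\<integral>\<^sup>+\<omega>. emeasure (distr M B Y) {y \<in> space B. P (X \<omega>) y} \<partial>M)"
    using XY by (intro nn_integral_cong arg_cong[where f="emeasure (distr M B Y)"])
      (auto simp: N_def space_pair_measure)
  finally show ?thesis .
qed

text \<open>Expected losses are integrals over the law of the new point, so the Gaussian results are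
  needed on that law, with the identity as the vector.\<close>

lemma gaussian_vector_distr:
  assumes X: "gaussian_vector M d S X"
  shows "gaussian_vector (distr M (rvec_borel d) X) d S (\<lambda>x. x)"
proof -
  have [measurable]: "X \<in> M \<rightarrow>\<^sub>M rvec_borel d"
    using X by (auto simp: gaussian_vector_def)
  have "distr (distr M (rvec_borel d) X) borel (\<lambda>x. dotp d u x) = distr M borel (\<lambda>\<omega>. dotp d u (X \<omega>))"
    if "u \<in> rvec d" for u
    using that by (subst distr_distr) (auto simp: space_PiM comp_def intro!: dotp_measurable)
  with X show ?thesis
    by (simp add: gaussian_vector_def)
qed

text \<open>The normalized score is standard normal, except that it is constantly 0 when the norm
  vanishes. In that case the event is empty, whence an inequality.\<close>

lemma gaussian_vector_tail:
  assumes S: "covariance_matrix d S" and X: "gaussian_vector M d S X" and w: "w \<in> rvec d" and K: "0 \<le> K"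
  shows "emeasure M {\<omega> \<in> space M. K < \<bar>dotp d w (X \<omega>) / snorm d S w\<bar>} \<le>
    emeasure std_normal_distribution {z. K < \<bar>z\<bar>}"
proof -
  have [measurable]: "X \<in> M \<rightarrow>\<^sub>M rvec_borel d" and
    law: "distr M borel (\<lambda>\<omega>. dotp d w (X \<omega>)) =
      distr std_normal_distribution borel (\<lambda>z. snorm d S w * z)"
    using X w by (auto simp: gaussian_vector_def snorm_def)
  have [measurable]: "(\<lambda>\<omega>. dotp d w (X \<omega>)) \<in> borel_measurable M"
    using w by (intro dotp_measurable) (auto simp: space_PiM)
  have "emeasure M {\<omega> \<in> space M. K < \<bar>dotp d w (X \<omega>) / snorm d S w\<bar>} =
      emeasure (distr M borel (\<lambda>\<omega>. dotp d w (X \<omega>))) {t. K < \<bar>t / snorm d S w\<bar>}"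
    by (subst emeasure_distr) (auto intro!: arg_cong[where f="emeasure M"])
  also have "\<dots> = emeasure std_normal_distribution {z. K < \<bar>snorm d S w * z / snorm d S w\<bar>}"
    unfolding law by (subst emeasure_distr) (simp_all add: vimage_def del: abs_divide times_divide_eq_left times_divide_eq_right nonzero_mult_div_cancel_left mult_divide_mult_cancel_left_if)
  also have "\<dots> \<le> emeasure std_normal_distribution {z. K < \<bar>z\<bar>}"
    using K by (intro emeasure_mono) (auto simp: abs_mult)
  finally show ?thesis .
qed

lemma std_normal_tail:
  assumes "0 < e"
  obtains K where "0 \<le> K" "measure std_normal_distribution {z. K < \<bar>z\<bar>} < e"
proof -
  interpret prob_space std_normal_distribution by (rule prob_space_std_normal)
  have "(\<lambda>i. prob {z. real i < \<bar>z\<bar>}) \<longlonglongrightarrow> prob (\<Inter>i. {z. real i < \<bar>z\<bar>})"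
    by (rule finite_Lim_measure_decseq) (auto simp: decseq_def)
  moreover have "(\<Inter>i. {z. real i < \<bar>z\<bar>}) = {}"
  proof -
    have "\<exists>i. \<not> real i < \<bar>x\<bar>" for x
      using reals_Archimedean2[of "\<bar>x\<bar>"] less_asym by blast
    then show ?thesis by auto
  qed
  ultimately have "(\<lambda>i. prob {z. real i < \<bar>z\<bar>}) \<longlonglongrightarrow> 0"
    by simp
  then have "\<forall>\<^sub>F i in sequentially. prob {z. real i < \<bar>z\<bar>} < e"
    using assms by (rule order_tendstoD)
  then obtain i where "prob {z. real i < \<bar>z\<bar>} < e"
    by (auto simp: eventually_sequentially)
  then show thesis
    by (intro that[of "real i"]) auto
qed

text \<open>For noise up to \<open>K\<close> the link is uniformly continuous on the relevant
  interval; for larger noise two link values differ by at most 1, which costs the tail probability.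
  The choice of \<delta> precedes \<open>r\<close> and \<open>u\<close>, so it serves all problem
  instances at once.\<close>

lemma f_ang_uniform:
  assumes cont: "continuous_on UNIV \<sigma>" and range: "\<And>t. \<sigma> t \<in> {0..1}" and e: "0 < e" and K: "0 \<le> K"
  obtains \<delta> where "0 < \<delta>"
    "\<And>r u \<theta> \<theta>'. \<bar>u / r\<bar> \<le> K \<Longrightarrow> \<bar>\<theta> - \<theta>'\<bar> < \<delta> \<Longrightarrow>
      \<bar>f_ang \<sigma> r \<theta> u - f_ang \<sigma> r \<theta>' u\<bar> \<le> e + measure std_normal_distribution {z. K < \<bar>z\<bar>}"
proof -
  interpret prob_space std_normal_distribution by (rule prob_space_std_normal)
  have [measurable]: "\<sigma> \<in> borel_measurable borel"
    by (rule borel_measurable_continuous_onI[OF cont])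
  \<comment> \<open>With normalized score and noise at most \<open>K\<close> in absolute value, the
    link argument is at most \<open>2 * K\<close>, as sine and cosine are bounded by 1.\<close>
  have "uniformly_continuous_on {-2*K..2*K} \<sigma>"
    by (intro compact_uniformly_continuous continuous_on_subset[OF cont]) auto
  then obtain \<eta> where \<eta>: "0 < \<eta>"
    "\<And>s t. \<bar>s\<bar> \<le> 2 * K \<Longrightarrow> \<bar>t\<bar> \<le> 2 * K \<Longrightarrow> \<bar>s - t\<bar> < \<eta> \<Longrightarrow> \<bar>\<sigma> s - \<sigma> t\<bar> < e"
    using e unfolding uniformly_continuous_on_def dist_real_def by (auto simp: abs_le_iff)
  \<comment> \<open>Sine and cosine are 1-Lipschitz, so the link argument moves by at most
    \<open>2 * K\<close> times the change of angle; the added 1 covers \<open>K = 0\<close>.\<close>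
  define \<delta> where "\<delta> = \<eta> / (2 * K + 1)"
  show thesis
  proof (rule that)
    show "0 < \<delta>" using \<eta>(1) K by (simp add: \<delta>_def)
  next
    fix r u \<theta> \<theta>' :: real assume u: "\<bar>u / r\<bar> \<le> K" and \<theta>: "\<bar>\<theta> - \<theta>'\<bar> < \<delta>"
    let ?a = "\<lambda>\<theta> z. cos \<theta> * (u / r) + sin \<theta> * z"
    have pt: "\<bar>\<sigma> (?a \<theta> z) - \<sigma> (?a \<theta>' z)\<bar> \<le> e + indicator {z. K < \<bar>z\<bar>} z" for z
    proof (cases "K < \<bar>z\<bar>")
      case True
      then show ?thesis using range[of "?a \<theta> z"] range[of "?a \<theta>' z"] e by (auto simp: abs_le_iff)
    next
      case False
      have bound: "\<bar>?a \<theta> z\<bar> \<le> 2 * K" for \<theta>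
      proof -
        have "\<bar>cos \<theta>\<bar> * \<bar>u / r\<bar> \<le> 1 * K" "\<bar>sin \<theta>\<bar> * \<bar>z\<bar> \<le> 1 * K"
          using u False by (intro mult_mono; simp)+
        then show ?thesis
          using abs_triangle_ineq[of "cos \<theta> * (u / r)" "sin \<theta> * z"] unfolding abs_mult by linarith
      qed
      have "\<bar>?a \<theta> z - ?a \<theta>' z\<bar> = \<bar>(cos \<theta> - cos \<theta>') * (u / r) + (sin \<theta> - sin \<theta>') * z\<bar>"
        by (simp add: algebra_simps diff_divide_distrib)
      also have "\<dots> \<le> \<bar>cos \<theta> - cos \<theta>'\<bar> * \<bar>u / r\<bar> + \<bar>sin \<theta> - sin \<theta>'\<bar> * \<bar>z\<bar>"
        using abs_triangle_ineq[of "(cos \<theta> - cos \<theta>') * (u / r)" "(sin \<theta> - sin \<theta>') * z"] unfolding abs_mult .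
      also have "\<dots> \<le> \<bar>\<theta> - \<theta>'\<bar> * K + \<bar>\<theta> - \<theta>'\<bar> * K"
      proof -
        have "\<bar>cos \<theta> - cos \<theta>'\<bar> \<le> 1 * \<bar>\<theta> - \<theta>'\<bar>"
          using field_differentiable_bound[of UNIV cos "\<lambda>t. - sin t" 1 \<theta> \<theta>']
          by (auto simp: dist_real_def intro!: derivative_eq_intros)
        moreover have "\<bar>sin \<theta> - sin \<theta>'\<bar> \<le> 1 * \<bar>\<theta> - \<theta>'\<bar>"
          using field_differentiable_bound[of UNIV sin cos 1 \<theta> \<theta>']
          by (auto simp: dist_real_def intro!: derivative_eq_intros)
        ultimately show ?thesis
          using u False by (intro add_mono mult_mono) auto
      qed
      also have "\<dots> = \<bar>\<theta> - \<theta>'\<bar> * (2 * K)" by simp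
      also have "\<dots> \<le> \<bar>\<theta> - \<theta>'\<bar> * (2 * K + 1)"
        by (intro mult_left_mono) auto
      also have "\<dots> < \<eta>"
        using \<theta> K by (simp add: \<delta>_def pos_less_divide_eq)
      finally have "\<bar>\<sigma> (?a \<theta> z) - \<sigma> (?a \<theta>' z)\<bar> < e"
        by (intro \<eta>(2) bound)
      with False show ?thesis by simp
    qed
    note int = link_integrable[of \<sigma>, OF _ range]
    have "\<bar>f_ang \<sigma> r \<theta> u - f_ang \<sigma> r \<theta>' u\<bar> = \<bar>expectation (\<lambda>z. \<sigma> (?a \<theta> z) - \<sigma> (?a \<theta>' z))\<bar>"
      unfolding f_ang_def by (subst Bochner_Integration.integral_diff) (auto intro!: int)
    also have "\<dots> \<le> expectation (\<lambda>z. \<bar>\<sigma> (?a \<theta> z) - \<sigma> (?a \<theta>' z)\<bar>)"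
      by (rule integral_abs_bound)
    also have "\<dots> \<le> expectation (\<lambda>z. e + indicator {z. K < \<bar>z\<bar>} z)"
      by (intro integral_mono pt integrable_abs Bochner_Integration.integrable_diff
          Bochner_Integration.integrable_add int) (auto simp: emeasure_eq_measure)
    also have "\<dots> = e + prob {z. K < \<bar>z\<bar>}"
      using prob_space by (subst Bochner_Integration.integral_add) (auto simp: emeasure_eq_measure)
    finally show "\<bar>f_ang \<sigma> r \<theta> u - f_ang \<sigma> r \<theta>' u\<bar> \<le> e + prob {z. K < \<bar>z\<bar>}" .
  qed
qed

section \<open>The minimizer for fixed and for random weights\<close>

lemma bregman_minimizer_iff:
  assumes M: "prob_space M" and S: "covariance_matrix d S" and X: "gaussian_vector M d S X"
    and wstar: "wstar \<in> rvec d" and wstar_norm: "snorm d S wstar = 1" and w: "w \<in> rvec d"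
    and link [measurable]: "\<sigma> \<in> borel_measurable borel" and range: "\<And>t. \<sigma> t \<in> {0..1}"
    and phi: "strictly_convex \<phi>" "\<And>q. \<phi> differentiable (at q)"
  shows "bregman_minimizer \<phi> \<sigma> d (distr M (rvec_borel d) X) wstar w F \<longleftrightarrow> F \<in> predictors \<and>
    (AE x in distr M (rvec_borel d) X.
      F (dotp d w x) = f_ang \<sigma> (snorm d S w) (sangle d S wstar w) (dotp d w x))"
proof -
  have [measurable]: "X \<in> M \<rightarrow>\<^sub>M rvec_borel d"
    using X by (auto simp: gaussian_vector_def)
  have N: "prob_space (distr M (rvec_borel d) X)"
    by (rule prob_space.prob_space_distr[OF M]) simp
  have meas [measurable]: "dotp d t \<in> borel_measurable (distr M (rvec_borel d) X)" if "t \<in> rvec d" for t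
    using that by (intro dotp_measurable) (auto simp: space_PiM)
  show ?thesis
    unfolding bregman_minimizer_def exp_bregman_def
  proof (rule bregman_arg_min_iff[OF phi N])
    fix h :: "real \<Rightarrow> real" and C assume h: "h \<in> borel_measurable borel" "\<And>u. \<bar>h u\<bar> \<le> C"
    show "(LINT x|distr M (rvec_borel d) X. \<sigma> (dotp d wstar x) * h (dotp d w x)) =
        (LINT x|distr M (rvec_borel d) X.
          f_ang \<sigma> (snorm d S w) (sangle d S wstar w) (dotp d w x) * h (dotp d w x))"
      by (rule gaussian_conditional_mean[OF N S gaussian_vector_distr[OF X] wstar wstar_norm w link range h])
  qed (use w wstar range f_ang_predictor[OF link range] in auto)
qed

text \<open>For each fixed weight vector the two predictors agree off a null set of new points, but
  these sets vary with the weights and their union need not be null. Joint measurability of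
  \<open>F\<close> makes disagreement an event; by independence its probability is the average over
  the weights of null sections.\<close>

lemma predictor_eq_f_ang_AE:
  assumes M: "prob_space M" and S: "covariance_matrix d S" and X: "gaussian_vector M d S X"
    and wstar: "wstar \<in> rvec d" and wstar_norm: "snorm d S wstar = 1"
    and indep: "indep_elements M (rvec_borel d) W (rvec_borel d) X"
    and link [measurable]: "\<sigma> \<in> borel_measurable borel" and range: "\<And>t. \<sigma> t \<in> {0..1}"
    and phi: "strictly_convex \<phi>" "\<And>q. \<phi> differentiable (at q)"
    and F: "measurable_family d F"
    and min: "AE \<omega> in M. bregman_minimizer \<phi> \<sigma> d (distr M (rvec_borel d) X) wstar (W \<omega>) (F (W \<omega>))"
  shows "AE \<omega> in M. F (W \<omega>) (dotp d (W \<omega>) (X \<omega>)) =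
    f_ang \<sigma> (snorm d S (W \<omega>)) (sangle d S wstar (W \<omega>)) (dotp d (W \<omega>) (X \<omega>))"
proof -
  interpret prob_space M by fact
  have [measurable]: "W \<in> M \<rightarrow>\<^sub>M rvec_borel d" "X \<in> M \<rightarrow>\<^sub>M rvec_borel d"
    using indep by (auto simp: indep_elements_def)
  note [measurable] = sangle_measurable[OF S wstar]
  have "(\<lambda>p. (fst p, dotp d (fst p) (snd p))) \<in>
      rvec_borel d \<Otimes>\<^sub>M rvec_borel d \<rightarrow>\<^sub>M rvec_borel d \<Otimes>\<^sub>M borel"
    by measurable
  from measurable_compose[OF this F[unfolded measurable_family_def]]
  have [measurable]: "(\<lambda>p. F (fst p) (dotp d (fst p) (snd p))) \<in> borel_measurable (rvec_borel d \<Otimes>\<^sub>M rvec_borel d)"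
    by simp
  define P where "P w x \<longleftrightarrow> F w (dotp d w x) \<noteq> f_ang \<sigma> (snorm d S w) (sangle d S wstar w) (dotp d w x)" for w x
  have P [measurable]: "Measurable.pred (rvec_borel d \<Otimes>\<^sub>M rvec_borel d) (\<lambda>(w, x). P w x)"
    unfolding P_def case_prod_beta by measurable
  have "emeasure M {\<omega> \<in> space M. P (W \<omega>) (X \<omega>)} =
      (\<integral>\<^sup>+\<omega>. emeasure (distr M (rvec_borel d) X) {x \<in> space (rvec_borel d). P (W \<omega>) x} \<partial>M)"
    by (rule indep_elements_emeasure[OF M indep P])
  also have "\<dots> = (\<integral>\<^sup>+\<omega>. 0 \<partial>M)"
  proof (rule nn_integral_cong_AE)
    show "AE \<omega> in M. emeasure (distr M (rvec_borel d) X) {x \<in> space (rvec_borel d). P (W \<omega>) x} = 0"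
      using min AE_space
    proof eventually_elim
      case (elim \<omega>)
      have W: "W \<omega> \<in> space (rvec_borel d)"
        using elim(2) by (rule measurable_space[rotated]) simp
      then have "W \<omega> \<in> rvec d" by (simp add: space_PiM)
      from elim(1) have "AE x in distr M (rvec_borel d) X. \<not> P (W \<omega>) x"
        unfolding P_def not_not
          bregman_minimizer_iff[OF M S X wstar wstar_norm \<open>W \<omega> \<in> rvec d\<close> link range phi] by blast
      moreover have "{x \<in> space (rvec_borel d). P (W \<omega>) x} \<in> sets (rvec_borel d)"
        using measurable_compose[OF measurable_Pair1'[OF W] P] by (simp add: pred_def)
      ultimately show ?case
        by (subst (asm) AE_iff_measurable[where N="{x \<in> space (rvec_borel d). P (W \<omega>) x}"]) auto
    qed
  qed
  finally have "emeasure M {\<omega> \<in> space M. P (W \<omega>) (X \<omega>)} = 0" by simp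
  moreover have "{\<omega> \<in> space M. P (W \<omega>) (X \<omega>)} \<in> sets M"
    using measurable_compose[OF measurable_Pair P, of W M X] by (simp add: pred_def)
  ultimately have "AE \<omega> in M. \<not> P (W \<omega>) (X \<omega>)"
    by (subst AE_iff_measurable[where N="{\<omega> \<in> space M. P (W \<omega>) (X \<omega>)}"]) auto
  then show ?thesis by (simp add: P_def)
qed

text \<open>The bound for frozen weights depends on \<open>K\<close> only, so it survives averaging
  over the weights. This is the tightness of the normalized scores.\<close>

lemma indep_gaussian_tail:
  assumes M: "prob_space M" and S: "covariance_matrix d S" and X: "gaussian_vector M d S X"
    and indep: "indep_elements M (rvec_borel d) W (rvec_borel d) X" and K: "0 \<le> K"
  shows "measure M {\<omega> \<in> space M. K < \<bar>dotp d (W \<omega>) (X \<omega>) / snorm d S (W \<omega>)\<bar>} \<le>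
    measure std_normal_distribution {z. K < \<bar>z\<bar>}"
proof -
  interpret prob_space M by fact
  interpret Z: prob_space std_normal_distribution by (rule prob_space_std_normal)
  have W: "W \<in> M \<rightarrow>\<^sub>M rvec_borel d" and [measurable]: "X \<in> M \<rightarrow>\<^sub>M rvec_borel d"
    using indep by (auto simp: indep_elements_def)
  have "emeasure M {\<omega> \<in> space M. K < \<bar>dotp d (W \<omega>) (X \<omega>) / snorm d S (W \<omega>)\<bar>} =
      (\<integral>\<^sup>+\<omega>. emeasure (distr M (rvec_borel d) X)
        {x \<in> space (rvec_borel d). K < \<bar>dotp d (W \<omega>) x / snorm d S (W \<omega>)\<bar>} \<partial>M)"
    by (rule indep_elements_emeasure[OF M indep]) measurable
  also have "\<dots> \<le> (\<integral>\<^sup>+\<omega>. emeasure std_normal_distribution {z. K < \<bar>z\<bar>} \<partial>M)"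
  proof (rule nn_integral_mono)
    fix \<omega> assume "\<omega> \<in> space M"
    then have "W \<omega> \<in> rvec d"
      using measurable_space[OF W] by (simp add: space_PiM)
    then show "emeasure (distr M (rvec_borel d) X)
        {x \<in> space (rvec_borel d). K < \<bar>dotp d (W \<omega>) x / snorm d S (W \<omega>)\<bar>} \<le>
      emeasure std_normal_distribution {z. K < \<bar>z\<bar>}"
      using gaussian_vector_tail[OF S gaussian_vector_distr[OF X] _ K] by simp
  qed
  also have "\<dots> = emeasure std_normal_distribution {z. K < \<bar>z\<bar>}"
    by (simp add: emeasure_space_1)
  finally show ?thesis
    by (simp add: emeasure_eq_measure Z.emeasure_eq_measure)
qed


text \<open>The second conjunct guarantees that the jointly measurable choices over which the third
  one quantifies exist.\<close>

theorem theorem4p2: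
  fixes M :: "nat \<Rightarrow> 'a measure"
    and n d :: "nat \<Rightarrow> nat"
    and \<Sigma> :: "nat \<Rightarrow> nat \<Rightarrow> nat \<Rightarrow> real"
    and wstar :: "nat \<Rightarrow> nat \<Rightarrow> real"
    and \<sigma> :: "real \<Rightarrow> real"
    and X :: "nat \<Rightarrow> nat \<Rightarrow> 'a \<Rightarrow> nat \<Rightarrow> real"
    and Y :: "nat \<Rightarrow> nat \<Rightarrow> 'a \<Rightarrow> bool"
    and train :: "nat \<Rightarrow> 'a \<Rightarrow> sample"
    and H :: "nat \<Rightarrow> 'h measure"
    and heldout :: "nat \<Rightarrow> 'a \<Rightarrow> 'h"
    and xnew :: "nat \<Rightarrow> 'a \<Rightarrow> nat \<Rightarrow> real"
    and \<nu> :: "nat \<Rightarrow> (nat \<Rightarrow> real) measure"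
    and l :: "bool \<Rightarrow> real \<Rightarrow> real"
    and g :: "nat \<Rightarrow> (nat \<Rightarrow> real) \<Rightarrow> real"
    and west :: "nat \<Rightarrow> sample \<Rightarrow> nat \<Rightarrow> real"
    and what :: "nat \<Rightarrow> 'a \<Rightarrow> nat \<Rightarrow> real"
    and thetaest :: "nat \<Rightarrow> sample \<times> 'h \<Rightarrow> real"
    and thetahat thetastar :: "nat \<Rightarrow> 'a \<Rightarrow> real"
    and \<phi> :: "real ^ 2 \<Rightarrow> real"
  assumes prob: "\<And>k. prob_space (M k)"
    and n_lim: "filterlim n at_top sequentially"
    and d_lim: "filterlim d at_top sequentially"
    and cov: "\<And>k. covariance_matrix (d k) (\<Sigma> k)"
    and wstar_vec: "\<And>k. wstar k \<in> rvec (d k)"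
    and wstar_norm: "\<And>k. snorm (d k) (\<Sigma> k) (wstar k) = 1"
    and link_meas: "\<sigma> \<in> borel_measurable borel"
    and link_range: "\<And>t. \<sigma> t \<in> {0..1}"
    \<comment> \<open>training data\<close>
    and X_law: "\<And>k i. i < n k \<Longrightarrow> gaussian_vector (M k) (d k) (\<Sigma> k) (X k i)"
    and Y_law: "\<And>k i. i < n k \<Longrightarrow>
       cond_bernoulli (M k) (rvec_borel (d k)) (X k i) (Y k i) (\<lambda>x. \<sigma> (dotp (d k) (wstar k) x))"
    and XY_indep: "\<And>k. prob_space.indep_vars (M k)
       (\<lambda>_. rvec_borel (d k) \<Otimes>\<^sub>M count_space UNIV) (\<lambda>i \<omega>. (X k i \<omega>, Y k i \<omega>)) {..<n k}"
    and train_def: "\<And>k \<omega>. train k \<omega> = (\<lambda>i\<in>{..<n k}. (X k i \<omega>, Y k i \<omega>))"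
    \<comment> \<open>new point, independent of all observed data (training and held-out)\<close>
    and xnew_law: "\<And>k. gaussian_vector (M k) (d k) (\<Sigma> k) (xnew k)"
    and xnew_indep: "\<And>k. indep_elements (M k)
       (sample_space (n k) (d k) \<Otimes>\<^sub>M H k) (\<lambda>\<omega>. (train k \<omega>, heldout k \<omega>)) (rvec_borel (d k)) (xnew k)"
    and \<nu>_def: "\<And>k. \<nu> k = distr (M k) (rvec_borel (d k)) (xnew k)"
    \<comment> \<open>estimator of the weights, computed from the training data\<close>
    and loss_convex: "\<And>b. convex_on UNIV (l b)"
    and penalty_convex: "\<And>k. convex_fun_rvec (d k) (g k)"
    and west_meas: "\<And>k. west k \<in> sample_space (n k) (d k) \<rightarrow>\<^sub>M rvec_borel (d k)"
    and what_def: "\<And>k \<omega>. what k \<omega> = west k (train k \<omega>)"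
    and what_argmin: "\<And>k. AE \<omega> in M k.
       is_arg_min (reg_risk (n k) (d k) l (g k) (train k \<omega>)) (\<lambda>w. w \<in> rvec (d k)) (what k \<omega>)"
    and what_nonzero: "\<And>k. AE \<omega> in M k. snorm (d k) (\<Sigma> k) (what k \<omega>) \<noteq> 0"
    \<comment> \<open>angle and its estimator, computed from the observed data\<close>
    and thetastar_def: "\<And>k \<omega>. thetastar k \<omega> = sangle (d k) (\<Sigma> k) (wstar k) (what k \<omega>)"
    and thetaest_meas: "\<And>k. thetaest k \<in> borel_measurable (sample_space (n k) (d k) \<Otimes>\<^sub>M H k)"
    and thetahat_def: "\<And>k \<omega>. thetahat k \<omega> = thetaest k (train k \<omega>, heldout k \<omega>)"
    \<comment> \<open>Bregman function\<close>
    and phi_strict: "strictly_convex \<phi>"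
    and phi_diff: "\<And>q. \<phi> differentiable (at q)"
    and phi_finite: "\<And>k. integrable (\<nu> k) (\<lambda>x. \<phi> (prob_vec (\<sigma> (dotp (d k) (wstar k) x))))"
  shows
    "(\<forall>k. \<forall>w\<in>rvec (d k). \<exists>F. bregman_minimizer \<phi> \<sigma> (d k) (\<nu> k) (wstar k) w F \<and>
        (\<forall>G. bregman_minimizer \<phi> \<sigma> (d k) (\<nu> k) (wstar k) w G \<longrightarrow>
          (AE x in \<nu> k. prob_vec (G (dotp (d k) w x)) = prob_vec (F (dotp (d k) w x)))))
     \<and> (\<forall>k. \<exists>Fstar. measurable_family (d k) Fstar \<and>
          (\<forall>w\<in>rvec (d k). bregman_minimizer \<phi> \<sigma> (d k) (\<nu> k) (wstar k) w (Fstar w)))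
     \<and> (continuous_on UNIV \<sigma> \<longrightarrow>
        tendsto_0_in_prob M (\<lambda>k \<omega>. \<bar>thetahat k \<omega> - thetastar k \<omega>\<bar>) \<longrightarrow>
        (\<forall>Fstar. (\<forall>k. measurable_family (d k) (Fstar k)) \<longrightarrow>
          (\<forall>k. AE \<omega> in M k.
             bregman_minimizer \<phi> \<sigma> (d k) (\<nu> k) (wstar k) (what k \<omega>) (Fstar k (what k \<omega>))) \<longrightarrow>
          tendsto_0_in_prob M (\<lambda>k \<omega>.
            (norm (prob_vec (f_ang \<sigma> (snorm (d k) (\<Sigma> k) (what k \<omega>)) (thetahat k \<omega>)
                              (dotp (d k) (what k \<omega>) (xnew k \<omega>)))
                 - prob_vec (Fstar k (what k \<omega>) (dotp (d k) (what k \<omega>) (xnew k \<omega>)))))\<^sup>2)))"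
proof (intro conjI allI ballI impI)
  fix k w assume w: "w \<in> rvec (d k)"
  have iff: "bregman_minimizer \<phi> \<sigma> (d k) (\<nu> k) (wstar k) w F \<longleftrightarrow> F \<in> predictors \<and>
    (AE x in \<nu> k. F (dotp (d k) w x) =
      f_ang \<sigma> (snorm (d k) (\<Sigma> k) w) (sangle (d k) (\<Sigma> k) (wstar k) w) (dotp (d k) w x))" for F
    unfolding \<nu>_def
    by (rule bregman_minimizer_iff[OF prob cov xnew_law wstar_vec wstar_norm w link_meas link_range
          phi_strict phi_diff])
  show "\<exists>F. bregman_minimizer \<phi> \<sigma> (d k) (\<nu> k) (wstar k) w F \<and>
      (\<forall>G. bregman_minimizer \<phi> \<sigma> (d k) (\<nu> k) (wstar k) w G \<longrightarrow>
        (AE x in \<nu> k. prob_vec (G (dotp (d k) w x)) = prob_vec (F (dotp (d k) w x))))"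
    unfolding iff prob_vec_eq_iff using f_ang_predictor[OF link_meas link_range]
    by (intro exI[of _ "f_ang \<sigma> (snorm (d k) (\<Sigma> k) w) (sangle (d k) (\<Sigma> k) (wstar k) w)"]) simp
next
  fix k
  note [measurable] = sangle_measurable[OF cov wstar_vec, of k] link_meas
  let ?F = "\<lambda>w. f_ang \<sigma> (snorm (d k) (\<Sigma> k) w) (sangle (d k) (\<Sigma> k) (wstar k) w)"
  have "measurable_family (d k) ?F"
    unfolding measurable_family_def case_prod_beta by measurable
  moreover have "bregman_minimizer \<phi> \<sigma> (d k) (\<nu> k) (wstar k) w (?F w)" if "w \<in> rvec (d k)" for w
    unfolding \<nu>_def bregman_minimizer_iff[OF prob cov xnew_law wstar_vec wstar_norm that link_meas link_range
          phi_strict phi_diff]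
    using f_ang_predictor[OF link_meas link_range] by simp
  ultimately show "\<exists>Fstar. measurable_family (d k) Fstar \<and>
      (\<forall>w\<in>rvec (d k). bregman_minimizer \<phi> \<sigma> (d k) (\<nu> k) (wstar k) w (Fstar w))"
    by blast
next
  fix Fstar
  assume cont: "continuous_on UNIV \<sigma>"
    and theta_lim: "tendsto_0_in_prob M (\<lambda>k \<omega>. \<bar>thetahat k \<omega> - thetastar k \<omega>\<bar>)"
    and Fstar_meas: "\<forall>k. measurable_family (d k) (Fstar k)"
    and Fstar_min: "\<forall>k. AE \<omega> in M k.
      bregman_minimizer \<phi> \<sigma> (d k) (\<nu> k) (wstar k) (what k \<omega>) (Fstar k (what k \<omega>))"
  let ?u = "\<lambda>k \<omega>. dotp (d k) (what k \<omega>) (xnew k \<omega>)"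
  let ?r = "\<lambda>k \<omega>. snorm (d k) (\<Sigma> k) (what k \<omega>)"
  let ?X = "\<lambda>k \<omega>. (norm (prob_vec (f_ang \<sigma> (?r k \<omega>) (thetahat k \<omega>) (?u k \<omega>))
      - prob_vec (Fstar k (what k \<omega>) (?u k \<omega>))))\<^sup>2"
  have what_indep: "indep_elements (M k) (rvec_borel (d k)) (what k) (rvec_borel (d k)) (xnew k)" for k
  proof -
    have "(\<lambda>p. west k (fst p)) \<in> sample_space (n k) (d k) \<Otimes>\<^sub>M H k \<rightarrow>\<^sub>M rvec_borel (d k)"
      using west_meas[of k] by measurable
    from indep_elements_compose[OF prob xnew_indep this]
    show ?thesis by (simp add: what_def[abs_def])
  qed
  have what_meas: "what k \<in> M k \<rightarrow>\<^sub>M rvec_borel (d k)" and xnew_meas: "xnew k \<in> M k \<rightarrow>\<^sub>M rvec_borel (d k)" for k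
    using what_indep[of k] by (auto simp: indep_elements_def)
  have thetahat_meas: "thetahat k \<in> borel_measurable (M k)" for k
    using measurable_compose[OF _ thetaest_meas[of k]] xnew_indep[of k]
    by (auto simp: thetahat_def[abs_def] indep_elements_def)
  have u_meas: "?u k \<in> borel_measurable (M k)" for k
    by (intro dotp_measurable what_meas xnew_meas)
  have r_meas: "?r k \<in> borel_measurable (M k)" for k
    by (rule measurable_compose[OF what_meas snorm_measurable])
  have diff_meas: "(\<lambda>\<omega>. \<bar>thetahat k \<omega> - thetastar k \<omega>\<bar>) \<in> borel_measurable (M k)" for k
    using theta_lim by (auto simp: tendsto_0_in_prob_def)
  have X_meas: "?X k \<in> borel_measurable (M k)" for k
  proof -
    have "(\<lambda>\<omega>. Fstar k (what k \<omega>) (?u k \<omega>)) \<in> borel_measurable (M k)"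
      using measurable_compose[OF measurable_Pair[OF what_meas u_meas]
          Fstar_meas[rule_format, of k, unfolded measurable_family_def]] by simp
    then show ?thesis
      unfolding norm_prob_vec_diff using link_meas r_meas thetahat_meas u_meas by measurable
  qed
  have Fstar_eq: "AE \<omega> in M k. Fstar k (what k \<omega>) (?u k \<omega>) = f_ang \<sigma> (?r k \<omega>) (thetastar k \<omega>) (?u k \<omega>)" for k
    unfolding thetastar_def
    by (rule predictor_eq_f_ang_AE[OF prob cov xnew_law wstar_vec wstar_norm what_indep link_meas link_range
          phi_strict phi_diff Fstar_meas[rule_format]]) (use Fstar_min in \<open>simp add: \<nu>_def\<close>)
  show "tendsto_0_in_prob M ?X"
    unfolding tendsto_0_in_prob_def
  proof (intro conjI allI impI X_meas)
    fix \<epsilon> :: real assume "0 < \<epsilon>"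
    show "(\<lambda>k. measure (M k) {\<omega> \<in> space (M k). \<bar>?X k \<omega>\<bar> > \<epsilon>}) \<longlonglongrightarrow> 0"
    proof (rule order_tendstoI)
      fix a :: real assume "a < 0"
      then show "\<forall>\<^sub>F k in sequentially. a < measure (M k) {\<omega> \<in> space (M k). \<bar>?X k \<omega>\<bar> > \<epsilon>}"
        by (intro always_eventually allI) (rule less_le_trans[OF _ measure_nonneg])
    next
      fix \<eta> :: real assume "0 < \<eta>"
      \<comment> \<open>The bound \<open>\<epsilon> / 4\<close> controls the noise inside the
        predictor and joins the modulus \<open>\<epsilon> / 4\<close> to give
        \<open>\<epsilon> / 2\<close>; the bound \<open>\<eta> / 2\<close> controls the probability
        of a large score.\<close>
      obtain K where K: "0 \<le> K" "measure std_normal_distribution {z. K < \<bar>z\<bar>} < min (\<epsilon> / 4) (\<eta> / 2)"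
        by (rule std_normal_tail[of "min (\<epsilon> / 4) (\<eta> / 2)"]) (use \<open>0 < \<epsilon>\<close> \<open>0 < \<eta>\<close> in auto)
      obtain \<delta> where \<delta>: "0 < \<delta>" "\<And>r u \<theta> \<theta>'. \<bar>u / r\<bar> \<le> K \<Longrightarrow> \<bar>\<theta> - \<theta>'\<bar> < \<delta> \<Longrightarrow>
          \<bar>f_ang \<sigma> r \<theta> u - f_ang \<sigma> r \<theta>' u\<bar> \<le> \<epsilon> / 4 + measure std_normal_distribution {z. K < \<bar>z\<bar>}"
        by (rule f_ang_uniform[OF cont link_range _ K(1), of "\<epsilon> / 4"]) (use \<open>0 < \<epsilon>\<close> in auto)
      let ?A = "\<lambda>k. {\<omega> \<in> space (M k). K < \<bar>?u k \<omega> / ?r k \<omega>\<bar>}"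
      \<comment> \<open>Halving \<delta> turns the weak inequality off this event into the strict
        one that \<open>f_ang_uniform\<close> asks for.\<close>
      let ?B = "\<lambda>k. {\<omega> \<in> space (M k). \<bar>\<bar>thetahat k \<omega> - thetastar k \<omega>\<bar>\<bar> > \<delta> / 2}"
      have le: "measure (M k) {\<omega> \<in> space (M k). \<bar>?X k \<omega>\<bar> > \<epsilon>} \<le> \<eta> / 2 + measure (M k) (?B k)" for k
      proof -
        interpret prob_space "M k" by (rule prob)
        note [measurable] = u_meas[of k] r_meas[of k] diff_meas[of k]
        have "prob {\<omega> \<in> space (M k). \<bar>?X k \<omega>\<bar> > \<epsilon>} \<le> prob (?A k \<union> ?B k)"
        proof (rule finite_measure_mono_AE)
          show "AE \<omega> in M k. \<omega> \<in> {\<omega> \<in> space (M k). \<bar>?X k \<omega>\<bar> > \<epsilon>} \<longrightarrow> \<omega> \<in> ?A k \<union> ?B k"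
            using Fstar_eq[of k]
          proof eventually_elim
            case (elim \<omega>)
            show ?case
            proof (rule impI, rule ccontr)
              assume large: "\<omega> \<in> {\<omega> \<in> space (M k). \<bar>?X k \<omega>\<bar> > \<epsilon>}" and "\<omega> \<notin> ?A k \<union> ?B k"
              then have "\<bar>?u k \<omega> / ?r k \<omega>\<bar> \<le> K" "\<bar>thetahat k \<omega> - thetastar k \<omega>\<bar> < \<delta>"
                using \<delta>(1) by auto
              from \<delta>(2)[OF this] have "\<bar>f_ang \<sigma> (?r k \<omega>) (thetahat k \<omega>) (?u k \<omega>) - Fstar k (what k \<omega>) (?u k \<omega>)\<bar> \<le> \<epsilon> / 2"
                (is "\<bar>?D\<bar> \<le> _") using K(2) unfolding elim by linarith
              \<comment> \<open>Since \<open>\<bar>?D\<bar>\<close> is at most 1, its square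
                inherits the bound \<open>\<epsilon> / 2\<close>, and the factor 2 of
                \<open>norm_prob_vec_diff\<close> brings it to \<epsilon>.\<close>
              moreover have "\<bar>?D\<bar> \<le> 1"
                using f_ang_range[OF link_meas link_range] unfolding elim by (auto simp: abs_le_iff) (smt (verit))+
              ultimately have "\<bar>?D\<bar> * \<bar>?D\<bar> \<le> \<epsilon> / 2 * 1"
                using \<open>0 < \<epsilon>\<close> by (intro mult_mono) auto
              then have "2 * ?D\<^sup>2 \<le> \<epsilon>"
                by (simp add: power2_eq_square)
              with large show False
                by (simp add: norm_prob_vec_diff)
            qed
          qed
        qed measurable
        also have "\<dots> \<le> prob (?A k) + prob (?B k)"
          by (rule measure_Un_le) measurable
        also have "prob (?A k) \<le> \<eta> / 2"
          using indep_gaussian_tail[OF prob cov xnew_law what_indep K(1), of k] K(2) by simp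
        finally show ?thesis by simp
      qed
      have "(\<lambda>k. measure (M k) (?B k)) \<longlonglongrightarrow> 0"
        using theta_lim \<delta>(1) unfolding tendsto_0_in_prob_def by (auto dest!: spec[of _ "\<delta> / 2"])
      then have "\<forall>\<^sub>F k in sequentially. measure (M k) (?B k) < \<eta> / 2"
        by (rule order_tendstoD(2)) (use \<open>0 < \<eta>\<close> in simp)
      then show "\<forall>\<^sub>F k in sequentially. measure (M k) {\<omega> \<in> space (M k). \<bar>?X k \<omega>\<bar> > \<epsilon>} < \<eta>"
      proof eventually_elim
        case (elim k)
        with le[of k] show ?case by linarith
      qed
    qed
  qed
qed

end
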